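(* Fix $n$ and a partition $z$ of $[n]$ with nonempty communities $\{C_k\}_{k=1}^{K(z)}$ and set of distinct blocks $\mathcal B(z)$. Assume the collapsed model satisfies the factorization $$p(Y\mid z)=\Big(\prod_{k=1}^{K(z)}m^{\mathrm{in}}(Y_{C_k})\Big)\Big(\prod_{(r,s)\in\mathcal B(z),\ r\ne s}m^{\mathrm{out}}_{rs}(Y_{rs})\Big),\qquad m^{\mathrm{in}}(Y_{C_k})=\sum_{t\in\mathcal T}\pi(t)\,m_{k,t}(Y_{C_k}),$$ where $|\mathcal T|<\infty$ and $\pi(t)>0$ for all $t\in\mathcal T$, and $$m^{\mathrm{out}}_{rs}(Y_{rs})=\int_{\Theta_{rs}}p(Y_{rs}\mid\theta_{rs})\,\pi^{\mathrm{out}}_{rs}(\theta_{rs})\,d\theta_{rs},\qquad m_{k,t}(Y_{C_k})=\int_{\Xi_{k,t}}p_t(Y_{C_k}\mid\Theta)\,\pi_t(\Theta)\,d\Theta .$$ For each $(r,s)\in\mathcal B(z)$ let $n_{rs}$ denote the effective sample size (number of independent dyads/observations contributing to $\log p(Y_{rs}\mid\theta_{rs})$), and assume that the Laplace expansion lemma stated in the context applies to $m^{\mathrm{out}}_{rs}(Y_{rs})$ with sample size $n_{rs}$ and effective dimension $d_{rs}$. For each community $k$ and type $t\in\mathcal T$, let $N_k$ denote the effective within-community sample size for that type (e.g. $N_k=|C_k|$ for node-level likelihoods, or $N_k=|\mathcal D_{kk}(z)|$ for dyadwise likelihoods), and define $N_k^+:=\max\{N_k,1\}$. Assume the Laplace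 expansion lemma applies to $m_{k,t}(Y_{C_k})$ with sample size $N_k^+$ and effective dimension $d_{k,t}$ (uniformly in $k$ and $t$). Then, as the relevant block sample sizes diverge, $$\log p(Y\mid z)=\sum_{(r,s)\in\mathcal B(z),\ r\ne s}\Big(\sup_{\theta_{rs}\in\Theta_{rs}}\log p(Y_{rs}\mid\theta_{rs})-\frac{d_{rs}}2\log n_{rs}\Big)+\sum_{k=1}^{K(z)}\max_{t\in\mathcal T}\Big(\sup_{\Theta\in\Xi_{k,t}}\log p_t(Y_{C_k}\mid\Theta)-\frac{d_{k,t}}2\log N_k^+\Big)+O\big(|\mathcal B(z)|+K(z)\big).$$ In particular, in regimes where $K(z)$ is uniformly bounded in $n$ (or more generally $K(z)=O(\log n)$), the remainder is $O(K(z)\log n)$. Consequently, refinements that increase model dimension introduce additional negative terms of order $\tfrac12\log(\text{sample size})$ per effective parameter and are disfavored unless supported by commensurate gains in maximized fit.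
   Context: Data are dyad observations $Y=\{y_{ij}:(i,j)\in\mathcal D\}$ on $[n]=\{1,\dots,n\}$, with $\mathcal D=\{(i,j):1\le i<j\le n\}$ (undirected) or $\{(i,j):1\le i\neq j\le n\}$ (directed). A partition is a label vector $z=(z_1,\dots,z_n)$, $C_k=\{i:z_i=k\}$, and $K(z)$ is the number of nonempty communities. $\mathcal D_{rs}(z)=\{(i,j)\in\mathcal D:z_i=r,z_j=s\}$, $Y_{rs}$ is the data on the dyads of block $(r,s)$, $Y_{C_k}$ is the data inside $C_k$, and $\mathcal B(z)$ is the set of distinct blocks (pairs with $r\le s$ in the undirected case; ordered pairs in the directed case). $\mathcal T$ is a set of within-community structural types with prior weights $\pi(t)$; $p_t(\cdot\mid\Theta)$, $\Theta\in\Xi_{k,t}$, is the within-community likelihood of type $t$ with parameter prior density $\pi_t$; $p(Y_{rs}\mid\theta_{rs})$, $\theta_{rs}\in\Theta_{rs}$, is the block likelihood with prior density $\pi^{\mathrm{out}}_{rs}$. Laplace expansion lemma. Let $\Omega\subset\mathbb R^d$ be open and $\ell_N:\Omega\to\mathbb R$ three times continuously differentiable (here the log-likelihood). Let $\pi$ be a proper prior density on $\Omega$ that is continuous and strictly positive at the maximizer below. Assume: (L1) there is a unique $\hat\vartheta_N\in\Omega$ with $\ell_N(\hat\vartheta_N)=\sup_{\vartheta\in\Omega}\ell_N(\vartheta)$; (L2) $J_N:=-\nabla^2\ell_N(\hat\vartheta_N)$ is positive definite and there exist constants $0<c<C<\infty$, independent of $N$, with $cN\le\lambda_{\min}(J_N)\le\lambda_{\max}(J_N)\le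 CN$ for all sufficiently large $N$; (L3) there exist $\rho>0$ and $M<\infty$ such that $\sup_{\|\vartheta-\hat\vartheta_N\|\le\rho}\|\nabla^3\ell_N(\vartheta)\|\le MN$ for all sufficiently large $N$, where $\|\cdot\|$ is any fixed operator/tensor norm; (L4) there exist $\rho>0$ and $\gamma>0$ such that $\sup_{\vartheta:\|\vartheta-\hat\vartheta_N\|\ge\rho}\ell_N(\vartheta)\le\ell_N(\hat\vartheta_N)-\gamma N$ for all sufficiently large $N$. Then $m_N:=\int_\Omega e^{\ell_N(\vartheta)}\pi(\vartheta)\,d\vartheta$ satisfies $m_N=\exp\{\ell_N(\hat\vartheta_N)\}\,\pi(\hat\vartheta_N)\,(2\pi)^{d/2}|J_N|^{-1/2}(1+o(1))$ (in the factor $(2\pi)^{d/2}$, $\pi$ is the number), and therefore $\log m_N=\ell_N(\hat\vartheta_N)-\frac d2\log N+O(1)$. If $\vartheta$ is constrained to a smooth $d_{\mathrm{eff}}$-dimensional manifold and (L1)--(L4) hold in local coordinates on that manifold, the same conclusions hold with $d$ replaced by $d_{\mathrm{eff}}$ (the effective dimension). The lemma "applies" to a marginal with given sample size and effective dimension when its hypotheses hold for that marginal with $N$ equal to the sample size and $d$ (or $d_{\mathrm{eff}}$) equal to the effective dimension.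
   Formalization: (L4) is required for every radius ρ>0, not just one; the prior density must be bounded below and equicontinuous at the maximizers, uniformly over all blocks, communities and types; effective dimensions are bounded. Without these the log expansion can fail. *)

theory Defs
  imports
    "HOL-Analysis.Analysis"
    "HOL-Library.Landau_Symbols"
    "Jordan_Normal_Form.Char_Poly"
begin

section \<open>Calculus on \<open>\<real>\<^sup>d\<close> with \<open>d\<close> a natural number\<close>

text \<open>Effective dimensions vary from block to block, so \<open>\<real>\<^sup>d\<close> cannot be a type. Its points are the
  extensional functions on \<open>{..<d}\<close>, which is the carrier both of \<open>powertop_real {..<d}\<close> and of the
  product Lebesgue measure below.\<close>

abbreviation leb :: "nat \<Rightarrow> (nat \<Rightarrow> real) measure" where
  "leb d \<equiv> \<Pi>\<^sub>M i\<in>{..<d}. lborel"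

definition edist :: "nat \<Rightarrow> (nat \<Rightarrow> real) \<Rightarrow> (nat \<Rightarrow> real) \<Rightarrow> real" where
  "edist d u v = L2_set (\<lambda>i. u i - v i) {..<d}"

definition partial :: "nat \<Rightarrow> ((nat \<Rightarrow> real) \<Rightarrow> real) \<Rightarrow> (nat \<Rightarrow> real) \<Rightarrow> real" where
  "partial i f u = deriv (\<lambda>t. f (u(i := t))) (u i)"

text \<open>\<open>C_on d k U f\<close>: \<open>f\<close> is \<open>k\<close> times continuously differentiable on the open set \<open>U \<subseteq> \<real>\<^sup>d\<close>.\<close>

fun C_on :: "nat \<Rightarrow> nat \<Rightarrow> (nat \<Rightarrow> real) set \<Rightarrow> ((nat \<Rightarrow> real) \<Rightarrow> real) \<Rightarrow> bool" where
  "C_on d 0 U f \<longleftrightarrow> continuous_map (subtopology (powertop_real {..<d}) U) euclideanreal f"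
| "C_on d (Suc k) U f \<longleftrightarrow>
     continuous_map (subtopology (powertop_real {..<d}) U) euclideanreal f \<and>
     (\<forall>i<d. (\<forall>u\<in>U. (\<lambda>t. f (u(i := t))) differentiable (at (u i))) \<and> C_on d k U (partial i f))"

definition neg_hessian :: "nat \<Rightarrow> ((nat \<Rightarrow> real) \<Rightarrow> real) \<Rightarrow> (nat \<Rightarrow> real) \<Rightarrow> real mat" where
  "neg_hessian d f u = Matrix.mat d d (\<lambda>(i, j). - partial i (partial j f) u)"

definition pos_def :: "nat \<Rightarrow> real mat \<Rightarrow> bool" where
  "pos_def d A \<longleftrightarrow> (\<forall>v\<in>carrier_vec d. v \<noteq> 0\<^sub>v d \<longrightarrow> 0 < v \<bullet> (A *\<^sub>v v))"

text \<open>The Hilbert--Schmidt norm of the third derivative tensor.\<close>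

definition norm_deriv3 :: "nat \<Rightarrow> ((nat \<Rightarrow> real) \<Rightarrow> real) \<Rightarrow> (nat \<Rightarrow> real) \<Rightarrow> real" where
  "norm_deriv3 d f u =
     L2_set (\<lambda>(i, j, l). partial i (partial j (partial l f)) u) ({..<d} \<times> {..<d} \<times> {..<d})"


section \<open>Parametric models on smooth manifolds\<close>

text \<open>A parameter space is a smooth manifold \<open>pm_space\<close> of dimension \<open>pm_dim\<close> (the effective dimension)
  with a smooth atlas, whose elements are pairs of a chart domain and a chart, and with a reference
  measure \<open>pm_vol\<close> (the \<open>d\<theta>\<close> of the marginal). An open \<open>\<Omega> \<subseteq> \<real>\<^sup>d\<close> is the case of the single chart
  \<open>(\<Omega>, \<lambda>u. u)\<close> and Lebesgue measure.\<close>

record ('y, 'p) param_model =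
  pm_dim :: nat
  pm_space :: "'p set"
  pm_atlas :: "('p set \<times> ('p \<Rightarrow> nat \<Rightarrow> real)) set"
  pm_vol :: "'p measure"
  pm_lik :: "(nat \<times> nat \<Rightarrow> 'y) \<Rightarrow> 'p \<Rightarrow> real"
  pm_prior :: "'p \<Rightarrow> real"

definition smooth_manifold ::
    "nat \<Rightarrow> 'p::{second_countable_topology, t2_space} set \<Rightarrow> ('p set \<times> ('p \<Rightarrow> nat \<Rightarrow> real)) set \<Rightarrow> bool" where
  "smooth_manifold d \<Theta> \<A> \<longleftrightarrow>
     (\<forall>(V, \<psi>)\<in>\<A>. openin (top_of_set \<Theta>) V \<and> openin (powertop_real {..<d}) (\<psi> ` V) \<and>
        homeomorphic_map (top_of_set V) (subtopology (powertop_real {..<d}) (\<psi> ` V)) \<psi>) \<and>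
     (\<Union>(V, \<psi>)\<in>\<A>. V) = \<Theta> \<and>
     (\<forall>(V, \<psi>)\<in>\<A>. \<forall>(V', \<psi>')\<in>\<A>. \<forall>j<d. \<forall>k.
        C_on d k (\<psi> ` (V \<inter> V')) (\<lambda>u. \<psi>' (inv_into V \<psi> u) j))"

text \<open>\<open>w\<close> is the density of \<open>\<mu>\<close> with respect to Lebesgue measure in the coordinates \<open>(V, \<psi>)\<close>.\<close>

definition coord_density ::
    "nat \<Rightarrow> 'p measure \<Rightarrow> 'p set \<Rightarrow> ('p \<Rightarrow> nat \<Rightarrow> real) \<Rightarrow> ((nat \<Rightarrow> real) \<Rightarrow> real) \<Rightarrow> bool" where
  "coord_density d \<mu> V \<psi> w \<longleftrightarrow>
     (\<forall>u\<in>\<psi> ` V. 0 < w u) \<and> (\<forall>k. C_on d k (\<psi> ` V) w) \<and>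
     distr (restrict_space \<mu> V) (leb d) \<psi> = density (leb d) (\<lambda>u. ennreal (indicator (\<psi> ` V) u * w u))"

definition smooth_measure ::
    "nat \<Rightarrow> 'p::{second_countable_topology, t2_space} set \<Rightarrow> ('p set \<times> ('p \<Rightarrow> nat \<Rightarrow> real)) set \<Rightarrow> 'p measure \<Rightarrow> bool" where
  "smooth_measure d \<Theta> \<A> \<mu> \<longleftrightarrow>
     sets \<mu> = sets (restrict_space borel \<Theta>) \<and> (\<forall>(V, \<psi>)\<in>\<A>. \<exists>w. coord_density d \<mu> V \<psi> w)"

text \<open>The classical case of an open subset of \<open>\<real>\<^sup>d\<close> with Lebesgue measure.\<close>

lemma topology_open_subset:
  assumes "\<Omega> \<subseteq> topspace (powertop_real {..<d})"
  shows "subtopology (powertop_real {..<d}) \<Omega> = top_of_set \<Omega>"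
proof -
  let ?P = "PiE {..<d} (\<lambda>_. UNIV::real set)"
  have c1: "continuous_map (powertop_real {..<d}) (powertop_real UNIV) (\<lambda>u. u)"
  proof (subst continuous_map_componentwise_UNIV, intro allI)
    fix i
    show "continuous_map (powertop_real {..<d}) euclideanreal (\<lambda>x. x i)"
    proof (cases "i < d")
      case False
      have "continuous_map (powertop_real {..<d}) euclideanreal (\<lambda>x. undefined)" by simp
      then show ?thesis
        by (rule continuous_map_eq) (use False in \<open>auto simp: PiE_iff extensional_def\<close>)
    qed (auto intro!: continuous_map_product_projection)
  qed
  have c2: "continuous_map (top_of_set ?P) (powertop_real {..<d}) (\<lambda>u. u)"
    unfolding continuous_map_componentwise euclidean_product_topology[symmetric]
    by (auto intro!: continuous_map_from_subtopology continuous_map_product_projection simp: PiE_iff)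
  have "openin (powertop_real {..<d}) A \<longleftrightarrow> openin (top_of_set ?P) A" for A
  proof
    assume o: "openin (powertop_real {..<d}) A"
    then have "A \<subseteq> ?P" using openin_subset by fastforce
    with openin_continuous_map_preimage[OF c2 o] show "openin (top_of_set ?P) A"
      by (simp add: Collect_conj_eq inf.absorb2 Int_absorb1)
  next
    assume "openin (top_of_set ?P) A"
    then obtain G where G: "open G" "A = ?P \<inter> G" by (auto simp: openin_open)
    have "openin (powertop_real {..<d}) {x \<in> topspace (powertop_real {..<d}). x \<in> G}"
      using openin_continuous_map_preimage[OF c1, of G] G(1)
      by (simp add: euclidean_product_topology)
    then show "openin (powertop_real {..<d}) A" by (simp add: G(2) Int_def)
  qed
  then have "powertop_real {..<d} = top_of_set ?P" by (simp add: topology_eq)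
  then show ?thesis using assms
    by (simp add: subtopology_subtopology Int_absorb1)
qed

lemma sets_leb: "sets (leb d) = sets (restrict_space borel (PiE {..<d} (\<lambda>_. UNIV)))"
proof -
  let ?P = "PiE {..<d} (\<lambda>_. UNIV::real set)"
  have sp: "space (leb d) = ?P" by (simp add: space_PiM)
  have m1: "(\<lambda>u. u) \<in> measurable (leb d) (borel :: (nat \<Rightarrow> real) measure)"
  proof -
    have "(\<lambda>u. u) \<in> measurable (leb d) (PiM UNIV (\<lambda>_. borel :: real measure))"
    proof (rule measurable_PiM_single')
      fix i :: nat
      show "(\<lambda>u. u i) \<in> borel_measurable (leb d)"
      proof (cases "i < d")
        case True
        then have "(\<lambda>u. u i) \<in> measurable (leb d) lborel" by simp
        then show ?thesis by simp
      next
        case False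
        have "(\<lambda>u. undefined) \<in> borel_measurable (leb d)" by simp
        then show ?thesis
          by (rule measurable_cong[THEN iffD1, rotated]) (use False in \<open>auto simp: space_PiM PiE_def extensional_def\<close>)
      qed
    qed (auto)
    then show ?thesis by (simp add: measurable_cong_sets[OF refl sets_PiM_equal_borel])
  qed
  have m2: "(\<lambda>u. restrict u {..<d}) \<in> measurable (borel :: (nat \<Rightarrow> real) measure) (leb d)"
  proof -
    have "(\<lambda>u. restrict u {..<d}) \<in> measurable (PiM UNIV (\<lambda>_. borel :: real measure)) (PiM {..<d} (\<lambda>_. borel))"
      by (rule measurable_restrict_subset) simp
    moreover have "sets (leb d) = sets (PiM {..<d} (\<lambda>_. borel))"
      by (rule sets_PiM_cong) auto
    ultimately show ?thesis
      by (simp add: measurable_cong_sets[OF sets_PiM_equal_borel refl] cong: measurable_cong_sets)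
  qed
  show "sets (leb d) = sets (restrict_space borel ?P)"
  proof (intro equalityI subsetI)
    fix A assume A: "A \<in> sets (leb d)"
    then have "A \<subseteq> ?P" using sets.sets_into_space sp by metis
    moreover have "(\<lambda>u. restrict u {..<d}) -` A \<in> sets borel"
      using measurable_sets[OF m2 A] by simp
    moreover have "A = ?P \<inter> (\<lambda>u. restrict u {..<d}) -` A"
      using \<open>A \<subseteq> ?P\<close> by (auto simp: PiE_restrict)
    ultimately show "A \<in> sets (restrict_space borel ?P)"
      by (auto simp: sets_restrict_space)
  next
    fix A assume "A \<in> sets (restrict_space borel ?P)"
    then obtain B where "B \<in> sets borel" "A = ?P \<inter> B" by (auto simp: sets_restrict_space)
    then show "A \<in> sets (leb d)" using measurable_sets[OF m1, of B] by (simp add: sp Int_commute)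
  qed
qed

lemma C_on_const: "C_on d k U (\<lambda>_. c)"
proof (induction k arbitrary: c)
  case (Suc k)
  have "partial i (\<lambda>_. c) = (\<lambda>_. 0)" for i by (auto simp: partial_def)
  then show ?case using Suc by auto
qed simp

lemma C_on_proj:
  assumes "j < d"
  shows "C_on d k U (\<lambda>u. u j)"
proof (cases k)
  case 0
  then show ?thesis
    using assms by (auto intro!: continuous_map_from_subtopology continuous_map_product_projection)
next
  case (Suc k')
  have "partial i (\<lambda>u. u j) = (\<lambda>_. if i = j then 1 else 0)" for i
    by (auto simp: partial_def)
  moreover have "(\<lambda>t. (u(i := t)) j) differentiable at (u i)" for i and u :: "nat \<Rightarrow> real"
    by (cases "i = j") auto
  ultimately show ?thesis unfolding Suc
    using assms by (auto intro!: continuous_map_from_subtopology continuous_map_product_projection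
      simp: C_on_const simp del: fun_upd_apply)
qed

lemma C_on_cong:
  assumes "openin (powertop_real {..<d}) U" "\<And>u. u \<in> U \<Longrightarrow> f u = g u" "C_on d k U f"
  shows "C_on d k U g"
  using assms(2,3)
proof (induction k arbitrary: f g)
  case 0
  then show ?case by (auto intro: continuous_map_eq)
next
  case (Suc k)
  have near: "eventually (\<lambda>t. f (u(i := t)) = g (u(i := t))) (nhds (u i))" if "i < d" "u \<in> U" for i u
  proof -
    have u: "u \<in> PiE {..<d} (\<lambda>_. UNIV)" using openin_subset[OF assms(1)] that by auto
    have "continuous_map euclideanreal (powertop_real {..<d}) (\<lambda>t. u(i := t))"
      unfolding continuous_map_componentwise
    proof (intro conjI ballI)
      fix j show "continuous_map euclideanreal euclideanreal (\<lambda>t. (u(i := t)) j)"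
        by (cases "i = j") auto
    qed (use u that in \<open>auto simp: PiE_iff extensional_def\<close>)
    from openin_continuous_map_preimage[OF this assms(1)]
    have "open {t. u(i := t) \<in> U}" by simp
    then show ?thesis
      using that Suc.prems(1) by (auto simp: eventually_nhds intro!: exI[of _ "{t. u(i := t) \<in> U}"])
  qed
  have "partial i f u = partial i g u" if "i < d" "u \<in> U" for i u
    unfolding partial_def by (intro deriv_cong_ev near that) simp
  moreover have "(\<lambda>t. g (u(i := t))) differentiable at (u i)" if "i < d" "u \<in> U" for i u
  proof -
    have "(\<lambda>t. f (u(i := t))) differentiable at (u i)" using Suc.prems(2) that by simp
    then obtain D where D: "((\<lambda>t. f (u(i := t))) has_real_derivative D) (at (u i))"
      by (auto simp: real_differentiable_def)
    have "((\<lambda>t. g (u(i := t))) has_real_derivative D) (at (u i))"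
      using D DERIV_cong_ev[OF refl near[OF that] refl] by simp
    then show ?thesis by (auto simp: real_differentiable_def)
  qed
  moreover have "continuous_map (subtopology (powertop_real {..<d}) U) euclideanreal g"
    using Suc.prems by (auto intro: continuous_map_eq)
  moreover have "C_on d k U (partial i g)" if "i < d" for i
  proof (rule Suc.IH)
    show "C_on d k U (partial i f)" using Suc.prems(2) that by simp
  qed (use calculation(1) that in auto)
  ultimately show ?case by simp
qed

lemma smooth_manifold_open:
  assumes "openin (powertop_real {..<d}) \<Omega>"
  shows "smooth_manifold d \<Omega> {(\<Omega>, \<lambda>u. u)}"
    and "smooth_measure d \<Omega> {(\<Omega>, \<lambda>u. u)} (restrict_space (leb d) \<Omega>)"
proof -
  have sub: "\<Omega> \<subseteq> PiE {..<d} (\<lambda>_. UNIV)" using openin_subset[OF assms] by simp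
  have top: "subtopology (powertop_real {..<d}) \<Omega> = top_of_set \<Omega>"
    using topology_open_subset openin_subset[OF assms] .
  have proj: "C_on d k \<Omega> (\<lambda>u. inv_into \<Omega> (\<lambda>u. u) u j)" if "j < d" for j k
    by (rule C_on_cong[OF assms _ C_on_proj[OF that]]) (metis f_inv_into_f image_ident)
  show "smooth_manifold d \<Omega> {(\<Omega>, \<lambda>u. u)}"
    using assms proj homeomorphic_map_id[of "top_of_set \<Omega>" "top_of_set \<Omega>"]
    by (auto simp: smooth_manifold_def top id_def)
  have "topspace (powertop_real {..<d}) = PiE {..<d} (\<lambda>_. UNIV)" by simp
  then have "openin (top_of_set (PiE {..<d} (\<lambda>_. UNIV))) \<Omega>"
    using assms topology_open_subset[OF order_refl, of d] by (metis subtopology_topspace)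
  then obtain G where "open G" "\<Omega> = PiE {..<d} (\<lambda>_. UNIV) \<inter> G"
    unfolding openin_open by blast
  then have meas: "\<Omega> \<in> sets (leb d)"
    unfolding sets_leb sets_restrict_space by (intro image_eqI[of _ _ G] borel_open)
  have "sets (restrict_space (leb d) \<Omega>) = sets (restrict_space (restrict_space borel (PiE {..<d} (\<lambda>_. UNIV))) \<Omega>)"
    by (rule sets_restrict_space_cong[OF sets_leb])
  also have "\<dots> = sets (restrict_space borel \<Omega>)"
    using sub by (simp only: sets_restrict_restrict_space Int_absorb1)
  finally have sets_eq: "sets (restrict_space (leb d) \<Omega>) = sets (restrict_space borel \<Omega>)" .
  have space: "space (restrict_space (leb d) \<Omega>) = \<Omega>"
    using sets.sets_into_space[OF meas] by (simp only: space_restrict_space Int_absorb2)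
  have restr: "restrict_space (restrict_space (leb d) \<Omega>) \<Omega> = restrict_space (leb d) \<Omega>"
    by (metis restrict_space_def restrict_space_sets_cong restrict_restrict_space meas sets.Int_space_eq2 Int_absorb)
  have "distr (restrict_space (leb d) \<Omega>) (leb d) (\<lambda>u. u) = density (leb d) (indicator \<Omega>)"
    (is "?L = ?R")
  proof (rule measure_eqI)
    fix A assume "A \<in> sets ?L"
    then have A: "A \<in> sets (leb d)" by (simp only: sets_distr)
    have "(\<lambda>u. u) \<in> measurable (restrict_space (leb d) \<Omega>) (leb d)"
      by (rule measurable_restrict_space1) (rule measurable_ident_sets[OF refl])
    then have "emeasure ?L A = emeasure (restrict_space (leb d) \<Omega>) (A \<inter> \<Omega>)"
      by (simp only: emeasure_distr[OF _ A] space vimage_ident)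
    also have "\<dots> = emeasure (leb d) (A \<inter> \<Omega>)"
      by (rule emeasure_restrict_space) (use meas in \<open>simp_all add: sets.Int_space_eq2\<close>)
    also have "\<dots> = emeasure ?R A"
    proof -
      have "emeasure ?R A = (\<integral>\<^sup>+ u. indicator (A \<inter> \<Omega>) u \<partial>leb d)"
        by (subst emeasure_density[OF borel_measurable_indicator[OF meas] A])
          (auto intro!: nn_integral_cong simp: indicator_def)
      then show ?thesis
        using A meas by (simp only: nn_integral_indicator sets.Int)
    qed
    finally show "emeasure ?L A = emeasure ?R A" .
  qed (simp only: sets_distr sets_density)
  moreover have "(\<lambda>u. ennreal (indicator \<Omega> u * 1)) = indicator \<Omega>"
    by (auto simp: indicator_def)
  ultimately have "coord_density d (restrict_space (leb d) \<Omega>) \<Omega> (\<lambda>u. u) (\<lambda>_. 1)"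
    unfolding coord_density_def restr image_ident by (simp only: C_on_const) simp
  then show "smooth_measure d \<Omega> {(\<Omega>, \<lambda>u. u)} (restrict_space (leb d) \<Omega>)"
    unfolding smooth_measure_def using sets_eq by blast
qed

definition proper_density :: "'p measure \<Rightarrow> ('p \<Rightarrow> real) \<Rightarrow> bool" where
  "proper_density \<mu> f \<longleftrightarrow>
     f \<in> borel_measurable \<mu> \<and> (\<forall>\<theta>\<in>space \<mu>. 0 \<le> f \<theta>) \<and> (\<integral>\<theta>. f \<theta> \<partial>\<mu>) = 1"

definition loglik :: "('y, 'p) param_model \<Rightarrow> (nat \<times> nat \<Rightarrow> 'y) \<Rightarrow> 'p \<Rightarrow> real" where
  "loglik M y \<theta> = ln (pm_lik M y \<theta>)"

definition marginal :: "('y, 'p) param_model \<Rightarrow> (nat \<times> nat \<Rightarrow> 'y) \<Rightarrow> real" where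
  "marginal M y = (LINT \<theta>:pm_space M|pm_vol M. pm_lik M y \<theta> * pm_prior M \<theta>)"

definition max_loglik :: "('y, 'p) param_model \<Rightarrow> (nat \<times> nat \<Rightarrow> 'y) \<Rightarrow> real" where
  "max_loglik M y = (SUP \<theta>\<in>pm_space M. loglik M y \<theta>)"

definition laplace_score :: "('y, 'p) param_model \<Rightarrow> (nat \<times> nat \<Rightarrow> 'y) \<Rightarrow> nat \<Rightarrow> real" where
  "laplace_score M y N = max_loglik M y - real (pm_dim M) / 2 * ln (real N)"

text \<open>The standing assumptions of the Laplace expansion lemma on a single marginal: smooth parameter
  space, real-valued \<open>C\<^sup>3\<close> log-likelihood, proper prior.\<close>

definition regular_model ::
    "('y, 'p::{second_countable_topology, t2_space}) param_model \<Rightarrow> (nat \<times> nat \<Rightarrow> 'y) \<Rightarrow> bool" where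
  "regular_model M y \<longleftrightarrow>
     smooth_manifold (pm_dim M) (pm_space M) (pm_atlas M) \<and>
     smooth_measure (pm_dim M) (pm_space M) (pm_atlas M) (pm_vol M) \<and>
     proper_density (pm_vol M) (pm_prior M) \<and>
     (\<forall>\<theta>\<in>pm_space M. 0 < pm_lik M y \<theta>) \<and>
     (\<forall>(V, \<psi>)\<in>pm_atlas M. C_on (pm_dim M) 3 (\<psi> ` V) (\<lambda>u. loglik M y (inv_into V \<psi> u)))"


section \<open>The hypotheses of the Laplace expansion lemma\<close>

text \<open>The hypotheses are stated for a family of marginals indexed by \<open>i \<in> I\<close>, with sample sizes \<open>N i\<close> and
  constants common to the family. The functions \<open>f i\<close> and \<open>g i\<close> are the log-likelihood and the prior
  density in a chart with image \<open>U i \<subseteq> \<real>\<^bsup>d i\<^esup>\<close>, and \<open>x i\<close> is the maximizer there.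

  The maximizers move with \<open>i\<close>, so ``continuous and strictly positive at the maximizer'' becomes
  equicontinuity and a common positive lower bound. Without this, or if the dimensions were unbounded, the
  remainder in the expansion of the logarithm would not be bounded over the family.\<close>

definition prior_cond ::
    "'i set \<Rightarrow> ('i \<Rightarrow> nat) \<Rightarrow> ('i \<Rightarrow> (nat \<Rightarrow> real) set) \<Rightarrow> ('i \<Rightarrow> (nat \<Rightarrow> real) \<Rightarrow> real) \<Rightarrow> ('i \<Rightarrow> nat \<Rightarrow> real) \<Rightarrow> bool" where
  "prior_cond I d U g x \<longleftrightarrow>
     (\<exists>a>0. \<forall>i\<in>I. a \<le> g i (x i)) \<and>
     (\<forall>\<epsilon>>0. \<exists>\<delta>>0. \<forall>i\<in>I. \<forall>u\<in>U i. edist (d i) u (x i) < \<delta> \<longrightarrow> \<bar>g i u - g i (x i)\<bar> < \<epsilon>)"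

definition cond_L1 :: "'p set \<Rightarrow> ('p \<Rightarrow> real) \<Rightarrow> 'p \<Rightarrow> bool" where
  "cond_L1 \<Theta> l \<theta> \<longleftrightarrow> \<theta> \<in> \<Theta> \<and> (\<forall>\<theta>'\<in>\<Theta>. \<theta>' \<noteq> \<theta> \<longrightarrow> l \<theta>' < l \<theta>)"

definition cond_L2 ::
    "'i set \<Rightarrow> ('i \<Rightarrow> nat) \<Rightarrow> ('i \<Rightarrow> nat) \<Rightarrow> ('i \<Rightarrow> (nat \<Rightarrow> real) \<Rightarrow> real) \<Rightarrow> ('i \<Rightarrow> nat \<Rightarrow> real) \<Rightarrow> bool" where
  "cond_L2 I N d f x \<longleftrightarrow>
     (\<forall>i\<in>I. pos_def (d i) (neg_hessian (d i) (f i) (x i))) \<and>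
     (\<exists>c C N0. 0 < c \<and> c < C \<and> (\<forall>i\<in>I. N0 \<le> N i \<longrightarrow>
        (\<forall>e. eigenvalue (neg_hessian (d i) (f i) (x i)) e \<longrightarrow>
             c * real (N i) \<le> e \<and> e \<le> C * real (N i))))"

text \<open>The closed ball has to lie in the domain \<open>U i\<close> of \<open>f i\<close>.\<close>

definition cond_L3 ::
    "'i set \<Rightarrow> ('i \<Rightarrow> nat) \<Rightarrow> ('i \<Rightarrow> nat) \<Rightarrow> ('i \<Rightarrow> (nat \<Rightarrow> real) set) \<Rightarrow> ('i \<Rightarrow> (nat \<Rightarrow> real) \<Rightarrow> real)
      \<Rightarrow> ('i \<Rightarrow> nat \<Rightarrow> real) \<Rightarrow> bool" where
  "cond_L3 I N d U f x \<longleftrightarrow>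
     (\<exists>\<rho>>0. \<exists>M N0. \<forall>i\<in>I. N0 \<le> N i \<longrightarrow>
        (\<forall>u\<in>topspace (powertop_real {..<d i}). edist (d i) u (x i) \<le> \<rho> \<longrightarrow>
           u \<in> U i \<and> norm_deriv3 (d i) (f i) u \<le> M * real (N i)))"

text \<open>The points of the manifold at distance at least \<open>\<rho>\<close> from \<open>\<theta>\<close>, in the coordinates \<open>(V, \<psi>)\<close>, include
  those outside the chart. The radius is arbitrary: with separation at a single radius only, a degenerate
  second local maximum inside that radius, with nearly the same value, could dominate the integral.\<close>

definition far :: "nat \<Rightarrow> 'p set \<Rightarrow> 'p set \<Rightarrow> ('p \<Rightarrow> nat \<Rightarrow> real) \<Rightarrow> 'p \<Rightarrow> real \<Rightarrow> 'p set" where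
  "far d \<Theta> V \<psi> \<theta> \<rho> = {\<theta>'\<in>\<Theta>. \<not> (\<theta>' \<in> V \<and> edist d (\<psi> \<theta>') (\<psi> \<theta>) < \<rho>)}"

definition cond_L4 ::
    "'i set \<Rightarrow> ('i \<Rightarrow> nat) \<Rightarrow> ('i \<Rightarrow> 'p \<Rightarrow> real) \<Rightarrow> ('i \<Rightarrow> 'p) \<Rightarrow> ('i \<Rightarrow> real \<Rightarrow> 'p set) \<Rightarrow> bool" where
  "cond_L4 I N l \<theta> F \<longleftrightarrow>
     (\<forall>\<rho>>0. \<exists>\<gamma>>0. \<exists>N0. \<forall>i\<in>I. N0 \<le> N i \<longrightarrow>
        (\<forall>\<theta>'\<in>F i \<rho>. l i \<theta>' \<le> l i (\<theta> i) - \<gamma> * real (N i)))"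

text \<open>\<open>M i\<close>, \<open>y i\<close>, \<open>N i\<close> are the model, data and sample size; \<open>(V i, \<psi> i)\<close> is a chart around the maximizer
  \<open>\<theta> i\<close> and \<open>w i\<close> the density of the reference measure in it.\<close>

definition laplace_applies ::
    "'i set \<Rightarrow> ('i \<Rightarrow> ('y, 'p::{second_countable_topology, t2_space}) param_model)
      \<Rightarrow> ('i \<Rightarrow> nat \<times> nat \<Rightarrow> 'y) \<Rightarrow> ('i \<Rightarrow> nat) \<Rightarrow> bool" where
  "laplace_applies I M y N \<longleftrightarrow>
     (\<forall>i\<in>I. regular_model (M i) (y i)) \<and>
     (\<exists>D. \<forall>i\<in>I. pm_dim (M i) \<le> D) \<and>
     (\<exists>\<theta> V \<psi> w.
        (\<forall>i\<in>I. (V i, \<psi> i) \<in> pm_atlas (M i) \<and> \<theta> i \<in> V i \<and>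
               coord_density (pm_dim (M i)) (pm_vol (M i)) (V i) (\<psi> i) (w i)) \<and>
        (let d = (\<lambda>i. pm_dim (M i));
             l = (\<lambda>i. loglik (M i) (y i));
             U = (\<lambda>i. \<psi> i ` V i);
             x = (\<lambda>i. \<psi> i (\<theta> i));
             f = (\<lambda>i u. l i (inv_into (V i) (\<psi> i) u));
             g = (\<lambda>i u. pm_prior (M i) (inv_into (V i) (\<psi> i) u) * w i u)
         in prior_cond I d U g x \<and>
            (\<forall>i\<in>I. cond_L1 (pm_space (M i)) (l i) (\<theta> i)) \<and>
            cond_L2 I N d f x \<and>
            cond_L3 I N d U f x \<and>
            cond_L4 I N l \<theta> (\<lambda>i. far (d i) (pm_space (M i)) (V i) (\<psi> i) (\<theta> i))))"


section \<open>Partitions and blocks\<close>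

definition dyads :: "bool \<Rightarrow> nat \<Rightarrow> (nat \<times> nat) set" where
  "dyads directed n =
     {(i, j). i \<in> {1..n} \<and> j \<in> {1..n} \<and> (if directed then i \<noteq> j else i < j)}"

definition communities :: "nat \<Rightarrow> (nat \<Rightarrow> nat) \<Rightarrow> nat set" where
  "communities n z = z ` {1..n}"

definition num_communities :: "nat \<Rightarrow> (nat \<Rightarrow> nat) \<Rightarrow> nat" where
  "num_communities n z = card (communities n z)"

definition blocks :: "bool \<Rightarrow> nat \<Rightarrow> (nat \<Rightarrow> nat) \<Rightarrow> (nat \<times> nat) set" where
  "blocks directed n z =
     {(r, s). r \<in> communities n z \<and> s \<in> communities n z \<and> (directed \<or> r \<le> s)}"

definition off_blocks :: "bool \<Rightarrow> nat \<Rightarrow> (nat \<Rightarrow> nat) \<Rightarrow> (nat \<times> nat) set" where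
  "off_blocks directed n z = {(r, s) \<in> blocks directed n z. r \<noteq> s}"

definition block_dyads :: "bool \<Rightarrow> nat \<Rightarrow> (nat \<Rightarrow> nat) \<Rightarrow> nat \<times> nat \<Rightarrow> (nat \<times> nat) set" where
  "block_dyads directed n z = (\<lambda>(r, s). {(i, j) \<in> dyads directed n. z i = r \<and> z j = s})"

text \<open>In the undirected case a dyad is stored as \<open>(i, j)\<close> with \<open>i < j\<close>, so the dyads joining \<open>r\<close> and \<open>s\<close>
  occur with either order of the labels, while only one of \<open>(r, s)\<close>, \<open>(s, r)\<close> is a block.\<close>

definition block_data ::
    "bool \<Rightarrow> nat \<Rightarrow> (nat \<Rightarrow> nat) \<Rightarrow> (nat \<times> nat \<Rightarrow> 'y) \<Rightarrow> nat \<times> nat \<Rightarrow> (nat \<times> nat \<Rightarrow> 'y)" where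
  "block_data directed n z Y = (\<lambda>(r, s). restrict Y
     (if directed then block_dyads directed n z (r, s)
      else block_dyads directed n z (r, s) \<union> block_dyads directed n z (s, r)))"

definition community_data ::
    "bool \<Rightarrow> nat \<Rightarrow> (nat \<Rightarrow> nat) \<Rightarrow> (nat \<times> nat \<Rightarrow> 'y) \<Rightarrow> nat \<Rightarrow> (nat \<times> nat \<Rightarrow> 'y)" where
  "community_data directed n z Y k = restrict Y (block_dyads directed n z (k, k))"


section \<open>Collapsed block models\<close>

text \<open>A specification for data on \<open>n\<close> nodes: a label vector, the block and within-community models with
  their effective sample sizes, and the collapsed likelihood \<open>cm_prob Y z\<close>, that is \<open>p(Y | z)\<close>. The
  within-community sample size may depend on the type.\<close>

record ('y, 't, 'p, 'q) collapsed_model =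
  cm_label :: "nat \<Rightarrow> nat"
  cm_out :: "nat \<times> nat \<Rightarrow> ('y, 'p) param_model"
  cm_out_size :: "nat \<times> nat \<Rightarrow> nat"
  cm_in :: "nat \<Rightarrow> 't \<Rightarrow> ('y, 'q) param_model"
  cm_in_size :: "nat \<Rightarrow> 't \<Rightarrow> nat"
  cm_prob :: "(nat \<times> nat \<Rightarrow> 'y) \<Rightarrow> (nat \<Rightarrow> nat) \<Rightarrow> real"

definition in_size_plus :: "('y, 't, 'p, 'q) collapsed_model \<Rightarrow> nat \<Rightarrow> 't \<Rightarrow> nat" where
  "in_size_plus S k t = max (cm_in_size S k t) 1"

definition factorizes ::
    "bool \<Rightarrow> 't set \<Rightarrow> ('t \<Rightarrow> real) \<Rightarrow> nat \<Rightarrow> (nat \<times> nat \<Rightarrow> 'y) \<Rightarrow> ('y, 't, 'p, 'q) collapsed_model \<Rightarrow> bool" where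
  "factorizes directed T \<pi> n Y S \<longleftrightarrow>
     cm_prob S Y (cm_label S) =
       (\<Prod>k\<in>communities n (cm_label S).
          \<Sum>t\<in>T. \<pi> t * marginal (cm_in S k t) (community_data directed n (cm_label S) Y k)) *
       (\<Prod>b\<in>off_blocks directed n (cm_label S).
          marginal (cm_out S b) (block_data directed n (cm_label S) Y b))"

definition log_prob :: "(nat \<times> nat \<Rightarrow> 'y) \<Rightarrow> ('y, 't, 'p, 'q) collapsed_model \<Rightarrow> real" where
  "log_prob Y S = ln (cm_prob S Y (cm_label S))"

definition in_score ::
    "bool \<Rightarrow> nat \<Rightarrow> (nat \<times> nat \<Rightarrow> 'y) \<Rightarrow> ('y, 't, 'p, 'q) collapsed_model \<Rightarrow> nat \<Rightarrow> 't \<Rightarrow> real" where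
  "in_score directed n Y S k t =
     laplace_score (cm_in S k t) (community_data directed n (cm_label S) Y k) (in_size_plus S k t)"

definition score ::
    "bool \<Rightarrow> 't set \<Rightarrow> nat \<Rightarrow> (nat \<times> nat \<Rightarrow> 'y) \<Rightarrow> ('y, 't, 'p, 'q) collapsed_model \<Rightarrow> real" where
  "score directed T n Y S =
     (\<Sum>b\<in>off_blocks directed n (cm_label S).
        laplace_score (cm_out S b) (block_data directed n (cm_label S) Y b) (cm_out_size S b)) +
     (\<Sum>k\<in>communities n (cm_label S). Max (in_score directed n Y S k ` T))"

definition log_remainder ::
    "bool \<Rightarrow> 't set \<Rightarrow> nat \<Rightarrow> (nat \<times> nat \<Rightarrow> 'y) \<Rightarrow> ('y, 't, 'p, 'q) collapsed_model \<Rightarrow> real" where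
  "log_remainder directed T n Y S = log_prob Y S - score directed T n Y S"

definition complexity :: "bool \<Rightarrow> nat \<Rightarrow> ('y, 't, 'p, 'q) collapsed_model \<Rightarrow> real" where
  "complexity directed n S =
     real (card (blocks directed n (cm_label S)) + num_communities n (cm_label S))"

text \<open>The score split into maximized fit and dimension penalty, for a selection \<open>\<tau>\<close> of one score-maximizing
  type per community.\<close>

definition best_types ::
    "bool \<Rightarrow> 't set \<Rightarrow> nat \<Rightarrow> (nat \<times> nat \<Rightarrow> 'y) \<Rightarrow> ('y, 't, 'p, 'q) collapsed_model \<Rightarrow> (nat \<Rightarrow> 't) \<Rightarrow> bool" where
  "best_types directed T n Y S \<tau> \<longleftrightarrow>
     (\<forall>k\<in>communities n (cm_label S). is_arg_max (in_score directed n Y S k) (\<lambda>t. t \<in> T) (\<tau> k))"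

definition fit ::
    "bool \<Rightarrow> nat \<Rightarrow> (nat \<times> nat \<Rightarrow> 'y) \<Rightarrow> ('y, 't, 'p, 'q) collapsed_model \<Rightarrow> (nat \<Rightarrow> 't) \<Rightarrow> real" where
  "fit directed n Y S \<tau> =
     (\<Sum>b\<in>off_blocks directed n (cm_label S).
        max_loglik (cm_out S b) (block_data directed n (cm_label S) Y b)) +
     (\<Sum>k\<in>communities n (cm_label S).
        max_loglik (cm_in S k (\<tau> k)) (community_data directed n (cm_label S) Y k))"

definition penalty :: "bool \<Rightarrow> nat \<Rightarrow> ('y, 't, 'p, 'q) collapsed_model \<Rightarrow> (nat \<Rightarrow> 't) \<Rightarrow> real" where
  "penalty directed n S \<tau> =
     (\<Sum>b\<in>off_blocks directed n (cm_label S). real (pm_dim (cm_out S b)) / 2 * ln (real (cm_out_size S b))) +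
     (\<Sum>k\<in>communities n (cm_label S).
        real (pm_dim (cm_in S k (\<tau> k))) / 2 * ln (real (in_size_plus S k (\<tau> k))))"

text \<open>The asymptotics are along a sequence of node counts, data and specifications. The hypotheses of the
  Laplace lemma hold uniformly over the blocks, resp. communities and types, of the whole sequence.\<close>

definition laplace_regime ::
    "bool \<Rightarrow> 't set \<Rightarrow> ('t \<Rightarrow> real) \<Rightarrow> (nat \<Rightarrow> nat) \<Rightarrow> (nat \<Rightarrow> nat \<times> nat \<Rightarrow> 'y) \<Rightarrow>
     (nat \<Rightarrow> ('y, 't, 'p::{second_countable_topology, t2_space},
                        'q::{second_countable_topology, t2_space}) collapsed_model) \<Rightarrow> bool" where
  "laplace_regime directed T \<pi> n Y S \<longleftrightarrow>
     (\<forall>\<nu>. factorizes directed T \<pi> (n \<nu>) (Y \<nu>) (S \<nu>)) \<and>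
     laplace_applies
       {(\<nu>, b). b \<in> off_blocks directed (n \<nu>) (cm_label (S \<nu>))}
       (\<lambda>(\<nu>, b). cm_out (S \<nu>) b)
       (\<lambda>(\<nu>, b). block_data directed (n \<nu>) (cm_label (S \<nu>)) (Y \<nu>) b)
       (\<lambda>(\<nu>, b). cm_out_size (S \<nu>) b) \<and>
     laplace_applies
       {(\<nu>, k, t). k \<in> communities (n \<nu>) (cm_label (S \<nu>)) \<and> t \<in> T}
       (\<lambda>(\<nu>, k, t). cm_in (S \<nu>) k t)
       (\<lambda>(\<nu>, k, t). community_data directed (n \<nu>) (cm_label (S \<nu>)) (Y \<nu>) k)
       (\<lambda>(\<nu>, k, t). in_size_plus (S \<nu>) k t)"

definition sizes_diverge ::
    "bool \<Rightarrow> 't set \<Rightarrow> (nat \<Rightarrow> nat) \<Rightarrow> (nat \<Rightarrow> ('y, 't, 'p, 'q) collapsed_model) \<Rightarrow> bool" where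
  "sizes_diverge directed T n S \<longleftrightarrow>
     (\<forall>m. \<forall>\<^sub>F \<nu> in sequentially.
        (\<forall>b\<in>off_blocks directed (n \<nu>) (cm_label (S \<nu>)). m \<le> cm_out_size (S \<nu>) b) \<and>
        (\<forall>k\<in>communities (n \<nu>) (cm_label (S \<nu>)). \<forall>t\<in>T. m \<le> in_size_plus (S \<nu>) k t))"

end

theory Submission
  imports Defs "HOL-Probability.Distributions"
begin

text \<open>By the factorization, \<open>log p(Y | z)\<close> is a sum of logarithms of marginals over the off-diagonal blocks
  and of logarithms of finite mixtures of marginals over the communities. It is therefore enough to know that
  each marginal satisfies \<open>log m = sup log-likelihood - d/2 log N + O(1)\<close>, with an error that is uniform over
  all blocks, communities and types of the sequence (\<open>laplace_applies_imp_log_marginal_bound\<close>). A finite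
  mixture with fixed positive weights equals its largest component up to a bounded factor
  (\<open>log_mixture_bound\<close>), so adding up the errors gives one constant per block and per community
  (\<open>log_remainder_bound\<close>). The other two claims are consequences: the number of blocks is at most
  \<open>K\<^sup>2\<close>, and comparing two specifications means subtracting two such expansions, in which the score is
  the maximized fit minus the dimension penalty.

  The uniform expansion is Laplace's method with two-sided bounds in place of the exact constant. In the chart
  around the maximizer the log-likelihood has a Taylor expansion along lines (\<open>taylor_along_line\<close>) whose
  first order term vanishes and whose second order term is pinched between the extreme eigenvalues of the
  symmetric Hessian (\<open>partial_commute\<close>, \<open>quadratic_form_eigenvalue_bounds\<close>); on a ball of fixed radius
  the third order term is dominated by the second (\<open>taylor_at_maximizer\<close>,
  \<open>quadratic_decay_from_taylor\<close>). Hence the marginal is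
  bounded below by an integral over a cube of side of order \<open>1 / \<surd>N\<close> and above by a Gaussian integral plus an
  exponentially small contribution from outside the ball (\<open>laplace_integral_bounds\<close>); both are of order
  \<open>N\<^sup>-\<^sup>d\<^sup>/\<^sup>2\<close> times the maximal likelihood.\<close>


section \<open>Calculus along lines\<close>

lemma openin_powertop_imp_relative_open:
  assumes "openin (powertop_real {..<d}) U"
  obtains G where "open G" "U = PiE {..<d} (\<lambda>_. UNIV) \<inter> G"
proof -
  have "openin (top_of_set (PiE {..<d} (\<lambda>_. UNIV))) U"
    using assms topology_open_subset[OF order_refl, of d] topspace_product_topology[of "\<lambda>_. euclideanreal" "{..<d}"]
    by (metis subtopology_topspace topspace_euclidean)
  then show thesis using that unfolding openin_open by blast
qed

lemma open_curve_preimage: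
  fixes p :: "'a::topological_space \<Rightarrow> nat \<Rightarrow> real"
  assumes U: "openin (powertop_real {..<d}) U"
    and "\<And>i. continuous_on UNIV (\<lambda>z. p z i)" and ext: "\<And>z. p z \<in> PiE {..<d} (\<lambda>_. UNIV)"
  shows "open {z. p z \<in> U}"
proof -
  obtain G where G: "open G" "U = PiE {..<d} (\<lambda>_. UNIV) \<inter> G"
    using openin_powertop_imp_relative_open[OF U] .
  have "continuous_on UNIV p"
    using assms(2) by (rule continuous_on_coordinatewise_then_product)
  then have "open (p -` G)" using G(1) by (simp add: open_vimage)
  moreover have "{z. p z \<in> U} = p -` G" using ext G(2) by auto
  ultimately show ?thesis by simp
qed

lemma continuous_on_of_C_on:
  assumes "openin (powertop_real {..<d}) U" "C_on d k U f"
  shows "continuous_on U f"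
proof -
  have "continuous_map (subtopology (powertop_real {..<d}) U) euclideanreal f"
    using assms(2) by (cases k) auto
  then show ?thesis unfolding topology_open_subset[OF openin_subset[OF assms(1)]] by simp
qed

text \<open>Derivatives of \<open>f\<close> are studied along curves \<open>p\<close> with one or two real parameters, since \<open>\<real>\<^sup>d\<close> is a set of
  functions and not a normed space. This carries continuity in the product topology over to the parameters.\<close>

lemma isCont_along_curve:
  fixes p :: "'a::t2_space \<Rightarrow> nat \<Rightarrow> real"
  assumes U: "openin (powertop_real {..<d}) U" and f: "C_on d k U f"
    and p: "\<And>i. continuous_on UNIV (\<lambda>z. p z i)" "\<And>z. p z \<in> PiE {..<d} (\<lambda>_. UNIV)"
    and z: "p z \<in> U"
  shows "isCont (\<lambda>z. f (p z)) z"
proof -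
  have "continuous_on UNIV p"
    using p(1) by (rule continuous_on_coordinatewise_then_product)
  then have "continuous_on {z. p z \<in> U} (\<lambda>z. f (p z))"
    by (intro continuous_on_compose2[OF continuous_on_of_C_on[OF U f]]) (auto intro: continuous_on_subset)
  then show ?thesis
    using open_curve_preimage[OF U p] z by (simp add: continuous_on_eq_continuous_at)
qed

lemma C_on_partial: "C_on d (Suc k) U f \<Longrightarrow> i < d \<Longrightarrow> C_on d k U (partial i f)"
  by simp

lemma has_real_derivative_partial:
  assumes "C_on d (Suc k) U f" "i < d" "u \<in> U"
  shows "((\<lambda>t. f (u(i := t))) has_real_derivative partial i f u) (at (u i))"
  using assms unfolding partial_def by (simp add: DERIV_deriv_iff_real_differentiable)

lemma has_real_derivative_partial_affine:
  assumes "C_on d (Suc k) U f" "i < d" "u(i := b + t * h) \<in> U"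
  shows "((\<lambda>s. f (u(i := b + s * h))) has_real_derivative h * partial i f (u(i := b + t * h))) (at t)"
proof -
  have "((\<lambda>s. f (u(i := s))) has_real_derivative partial i f (u(i := b + t * h))) (at (b + t * h))"
    using has_real_derivative_partial[OF assms] by simp
  moreover have "((\<lambda>s. b + s * h) has_real_derivative h) (at t)"
    by (auto intro!: derivative_eq_intros)
  ultimately show ?thesis
    by (rule DERIV_cong[OF DERIV_chain2[where f = "\<lambda>s. f (u(i := s))" and g = "\<lambda>s. b + s * h"]]) simp
qed

text \<open>Continuous partial derivatives give the chain rule. The induction lets one more coordinate move in each
  step: the new coordinate and the old ones are two independent parameters \<open>(s, t)\<close>, the derivative in
  \<open>s\<close> at the base point is the induction hypothesis, the derivative in \<open>t\<close> is a partial derivative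
  that is continuous in both, and so the function of \<open>(s, t)\<close> is differentiable and can be restricted to
  the diagonal.\<close>

lemma has_real_derivative_first_coordinates:
  assumes U: "openin (powertop_real {..<d}) U" and f: "C_on d (Suc k) U f"
    and u: "u \<in> U" and "m \<le> d"
  shows "((\<lambda>s. f (\<lambda>i. if i < m then u i + s * h i else u i)) has_real_derivative
           (\<Sum>i<m. h i * partial i f u)) (at 0)"
  using \<open>m \<le> d\<close>
proof (induction m)
  case 0
  then show ?case by simp
next
  case (Suc m)
  have uP: "u \<in> PiE {..<d} (\<lambda>_. UNIV)" using openin_subset[OF U] u by auto
  \<comment> \<open>\<open>fst z\<close> moves the first \<open>m\<close> coordinates, \<open>snd z\<close> moves coordinate \<open>m\<close>.\<close>
  define p where "p = (\<lambda>z::real \<times> real. (\<lambda>i. if i < m then u i + fst z * h i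
     else if i = m then u m + snd z * h m else u i))"
  have pc: "continuous_on UNIV (\<lambda>z. p z i)" for i
    unfolding p_def by (cases "i < m"; cases "i = m"; simp; intro continuous_intros)
  have pP: "p z \<in> PiE {..<d} (\<lambda>_. UNIV)" for z
    using uP Suc.prems by (auto simp: p_def PiE_iff extensional_def)
  have p0: "p (0, 0) = u" by (auto simp: p_def)
  have "(0, 0) \<in> {z. p z \<in> U}" using u p0 by simp
  then obtain A B where AB': "open A" "open B" "(0, 0) \<in> A \<times> B" "A \<times> B \<subseteq> {z. p z \<in> U}"
    by (rule open_prod_elim[OF open_curve_preimage[OF U pc pP]])
  then have AB: "open A" "open B" "0 \<in> A" "0 \<in> B" "A \<times> B \<subseteq> {z. p z \<in> U}" by auto
  obtain e where e: "e > 0" "ball 0 e \<subseteq> B"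
    using AB(2,4) openE by blast
  define Y where "Y = ball (0::real) e"
  have Y: "open Y" "convex Y" "0 \<in> Y" "Y \<subseteq> B" using e by (auto simp: Y_def)
  have inU: "p (s, t) \<in> U" if "s \<in> A" "t \<in> Y" for s t using that AB(5) Y(4) by blast
  let ?D = "\<lambda>s t. blinfun_mult_right (h m * partial m f (p (s, t)))"
  have d1: "((\<lambda>s. f (p (s, 0))) has_derivative (*) (\<Sum>i<m. h i * partial i f u)) (at 0 within A)"
  proof -
    have "p (s, 0) = (\<lambda>i. if i < m then u i + s * h i else u i)" for s
      by (auto simp: p_def)
    then have "((\<lambda>s. f (p (s, 0))) has_derivative (*) (\<Sum>i<m. h i * partial i f u)) (at 0)"
      using Suc.IH Suc.prems by (simp add: has_field_derivative_def)
    then show ?thesis by (rule has_derivative_at_withinI)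
  qed
  have d2: "((\<lambda>t. f (p (s, t))) has_derivative blinfun_apply (?D s t)) (at t within Y)"
    if "s \<in> A" "t \<in> Y" for s t
  proof -
    have eq: "p (s, t) = (p (s, 0))(m := u m + t * h m)" for t by (auto simp: p_def fun_eq_iff)
    have "((\<lambda>t. f ((p (s, 0))(m := u m + t * h m))) has_real_derivative
        h m * partial m f ((p (s, 0))(m := u m + t * h m))) (at t)"
      by (rule has_real_derivative_partial_affine[OF f]) (use Suc.prems inU[OF that] in \<open>simp_all add: eq[symmetric]\<close>)
    then have "((\<lambda>t. f (p (s, t))) has_derivative (*) (h m * partial m f (p (s, t)))) (at t)"
      unfolding eq[symmetric] has_field_derivative_def .
    then show ?thesis unfolding blinfun_mult_right.rep_eq by (rule has_derivative_at_withinI)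
  qed
  have "isCont (\<lambda>z. partial m f (p z)) (0, 0)"
    by (rule isCont_along_curve[OF U C_on_partial[OF f] pc pP]) (use Suc.prems u p0 in auto)
  then have "isCont (\<lambda>(s, t). ?D s t) (0, 0)"
    unfolding case_prod_unfold
    by (auto intro!: continuous_intros bounded_linear.isCont[OF bounded_linear_blinfun_mult_right])
  then have cont: "continuous (at (0, 0) within A \<times> Y) (\<lambda>(s, t). ?D s t)"
    by (rule continuous_at_imp_continuous_at_within)
  have "((\<lambda>(s, t). f (p (s, t))) has_derivative
      (\<lambda>(ts, tt). (\<Sum>i<m. h i * partial i f u) * ts + blinfun_apply (?D 0 0) tt)) (at (0, 0) within A \<times> Y)"
    by (rule has_derivative_partialsI[OF d1 d2 cont Y(3,2)])
  then have "((\<lambda>z. f (p z)) has_derivative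
      (\<lambda>z. (\<Sum>i<m. h i * partial i f u) * fst z + h m * partial m f u * snd z)) (at (0, 0))"
    using AB(1,3) Y(1,3)
    by (simp add: at_within_open[OF _ open_Times] case_prod_unfold p0 blinfun_mult_right.rep_eq)
  moreover have "((\<lambda>s::real. (s, s)) has_derivative (\<lambda>s. (s, s))) (at 0)"
    by (auto intro!: derivative_eq_intros)
  ultimately have "((\<lambda>s. f (p (s, s))) has_derivative
      (\<lambda>s. (\<Sum>i<m. h i * partial i f u) * s + h m * partial m f u * s)) (at 0)"
    using has_derivative_compose[where f = "\<lambda>s::real. (s, s)"] by fastforce
  moreover have "p (s, s) = (\<lambda>i. if i < Suc m then u i + s * h i else u i)" for s
    by (auto simp: p_def less_Suc_eq)
  moreover have "(\<lambda>s. (\<Sum>i<m. h i * partial i f u) * s + h m * partial m f u * s)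
      = (*) (\<Sum>i<Suc m. h i * partial i f u)"
    by (simp add: fun_eq_iff distrib_right)
  ultimately show ?case unfolding has_field_derivative_def by simp
qed

text \<open>The value has to stay extensional outside \<open>{..<d}\<close>, since the open sets of \<open>\<real>\<^sup>d\<close> consist of
  extensional functions.\<close>

definition line :: "nat \<Rightarrow> (nat \<Rightarrow> real) \<Rightarrow> (nat \<Rightarrow> real) \<Rightarrow> real \<Rightarrow> nat \<Rightarrow> real" where
  "line d x h t = (\<lambda>i\<in>{..<d}. x i + t * h i)"

lemma has_real_derivative_line:
  assumes U: "openin (powertop_real {..<d}) U" and f: "C_on d (Suc k) U f"
    and u: "line d x h t \<in> U"
  shows "((\<lambda>t. f (line d x h t)) has_real_derivative (\<Sum>i<d. h i * partial i f (line d x h t))) (at t)"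
proof -
  have "line d x h (s + t) = (\<lambda>i. if i < d then line d x h t i + s * h i else line d x h t i)" for s
    by (auto simp: line_def algebra_simps)
  then have "((\<lambda>s. f (line d x h (s + t))) has_real_derivative (\<Sum>i<d. h i * partial i f (line d x h t))) (at 0)"
    using has_real_derivative_first_coordinates[OF U f u order_refl, of h] by simp
  then show ?thesis
    using DERIV_shift[of "\<lambda>t. f (line d x h t)" _ 0 t] by simp
qed

text \<open>The second difference over a square is, by the mean value theorem in \<open>i\<close> and then in \<open>j\<close>, a value
  of one mixed partial derivative inside the square. It is symmetric in \<open>i\<close> and \<open>j\<close>, which is what
  makes the mixed derivatives commute.\<close>

lemma mixed_difference:
  assumes f: "C_on d (Suc (Suc k)) U f" and ij: "i < d" "j < d" "i \<noteq> j" and a: "0 < a"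
    and sq: "\<And>s t. s \<in> {0..a} \<Longrightarrow> t \<in> {0..a} \<Longrightarrow> u(i := u i + s, j := u j + t) \<in> U"
  obtains s t where "s \<in> {0<..<a}" "t \<in> {0<..<a}"
    "f (u(i := u i + a, j := u j + a)) - f (u(i := u i + a)) - f (u(j := u j + a)) + f u =
     a * a * partial j (partial i f) (u(i := u i + s, j := u j + t))"
proof -
  have swap: "u(i := s, j := t) = u(j := t, i := s)" for s t using ij by auto
  have d1: "((\<lambda>s. f (u(i := u i + s, j := u j + t))) has_real_derivative
      partial i f (u(i := u i + s, j := u j + t))) (at s)" if "s \<in> {0..a}" "t \<in> {0..a}" for s t
    using has_real_derivative_partial_affine[OF f ij(1), of "u(j := u j + t)" "u i" s 1] sq[OF that]
    by (simp add: swap)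
  have d2: "((\<lambda>t. partial i f (u(i := u i + s, j := u j + t))) has_real_derivative
      partial j (partial i f) (u(i := u i + s, j := u j + t))) (at t)" if "s \<in> {0..a}" "t \<in> {0..a}" for s t
    using has_real_derivative_partial_affine[OF C_on_partial[OF f ij(1)] ij(2), of "u(i := u i + s)" "u j" t 1] sq[OF that]
    by simp
  let ?G = "\<lambda>s. f (u(i := u i + s, j := u j + a)) - f (u(i := u i + s, j := u j + 0))"
  have "\<exists>s. 0 < s \<and> s < a \<and> ?G a - ?G 0 = (a - 0) *
      (partial i f (u(i := u i + s, j := u j + a)) - partial i f (u(i := u i + s, j := u j + 0)))"
    by (rule MVT2[OF a]) (intro DERIV_diff d1; use a in auto)
  then obtain s where s: "0 < s" "s < a" "?G a - ?G 0 = a *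
      (partial i f (u(i := u i + s, j := u j + a)) - partial i f (u(i := u i + s, j := u j + 0)))"
    by auto
  have "\<exists>t. 0 < t \<and> t < a \<and> partial i f (u(i := u i + s, j := u j + a)) - partial i f (u(i := u i + s, j := u j + 0))
      = (a - 0) * partial j (partial i f) (u(i := u i + s, j := u j + t))"
    by (rule MVT2[OF a]) (intro d2; use s in auto)
  then obtain t where t: "0 < t" "t < a" "partial i f (u(i := u i + s, j := u j + a)) - partial i f (u(i := u i + s, j := u j + 0))
      = a * partial j (partial i f) (u(i := u i + s, j := u j + t))"
    by auto
  have "?G a - ?G 0 = f (u(i := u i + a, j := u j + a)) - f (u(i := u i + a)) - f (u(j := u j + a)) + f u"
    using ij by (simp add: fun_upd_idem)
  then show thesis using that[of s t] s t by simp
qed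

text \<open>Applying \<open>mixed_difference\<close> in both orders gives, in every small square at \<open>u\<close>, a value of the one mixed
  derivative that equals a value of the other. If the two differed at \<open>u\<close>, continuity would separate their
  values on a small enough square.\<close>

lemma partial_commute:
  assumes U: "openin (powertop_real {..<d}) U" and f: "C_on d (Suc (Suc k)) U f"
    and ij: "i < d" "j < d" and u: "u \<in> U"
  shows "partial i (partial j f) u = partial j (partial i f) u"
proof (cases "i = j")
  case False
  show ?thesis
  proof (rule ccontr)
    let ?a = "partial i (partial j f)" and ?b = "partial j (partial i f)"
    assume neq: "?a u \<noteq> ?b u"
    define \<epsilon> where "\<epsilon> = \<bar>?a u - ?b u\<bar> / 2"
    have \<epsilon>: "0 < \<epsilon>" using neq by (simp add: \<epsilon>_def)
    define p where "p = (\<lambda>z::real \<times> real. u(i := u i + fst z, j := u j + snd z))"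
    have uP: "u \<in> PiE {..<d} (\<lambda>_. UNIV)" using openin_subset[OF U] u by auto
    have pc: "continuous_on UNIV (\<lambda>z. p z l)" for l
      unfolding p_def by (cases "l = i"; cases "l = j"; simp; intro continuous_intros)
    have pP: "p z \<in> PiE {..<d} (\<lambda>_. UNIV)" for z
      using uP ij by (auto simp: p_def PiE_iff extensional_def)
    have p0: "p 0 = u" by (auto simp: p_def)
    have Ca: "C_on d k U ?a" and Cb: "C_on d k U ?b" using f ij by auto
    have "\<forall>\<^sub>F z in nhds 0. p z \<in> U"
      using open_curve_preimage[OF U pc pP] p0 u by (auto simp: eventually_nhds)
    moreover have "\<forall>\<^sub>F z in nhds 0. dist (?a (p z)) (?a u) < \<epsilon>"
      using isCont_along_curve[OF U Ca pc pP] u \<epsilon> p0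
      by (metis continuous_at tendsto_at_iff_tendsto_nhds tendstoD)
    moreover have "\<forall>\<^sub>F z in nhds 0. dist (?b (p z)) (?b u) < \<epsilon>"
      using isCont_along_curve[OF U Cb pc pP] u \<epsilon> p0
      by (metis continuous_at tendsto_at_iff_tendsto_nhds tendstoD)
    ultimately have "\<forall>\<^sub>F z in nhds 0. p z \<in> U \<and> dist (?a (p z)) (?a u) < \<epsilon> \<and> dist (?b (p z)) (?b u) < \<epsilon>"
      by eventually_elim auto
    then obtain e where e: "0 < e"
      "\<And>z. dist z 0 < e \<Longrightarrow> p z \<in> U \<and> dist (?a (p z)) (?a u) < \<epsilon> \<and> dist (?b (p z)) (?b u) < \<epsilon>"
      unfolding eventually_nhds_metric by blast
    \<comment> \<open>The closed square of side \<open>e / 3\<close> lies in the ball of radius \<open>e\<close>.\<close>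
    define a where "a = e / 3"
    have a: "0 < a" using e by (simp add: a_def)
    have small: "dist (s, t) 0 < e" if "s \<in> {0..a}" "t \<in> {0..a}" for s t
    proof -
      have "dist (s, t) 0 \<le> \<bar>s\<bar> + \<bar>t\<bar>"
        by (simp add: dist_prod_def zero_prod_def sqrt_sum_squares_le_sum_abs)
      then show ?thesis using that e a by (auto simp: a_def)
    qed
    have sw: "u(j := t, i := s) = u(i := s, j := t)" for s t using False by auto
    have in1: "u(i := u i + s, j := u j + t) \<in> U" if "s \<in> {0..a}" "t \<in> {0..a}" for s t
      using e(2)[OF small[OF that]] by (simp add: p_def)
    have in2: "u(j := u j + t, i := u i + s) \<in> U" if "t \<in> {0..a}" "s \<in> {0..a}" for s t
      using in1[OF that(2,1)] sw by simp
    obtain s t where st: "s \<in> {0<..<a}" "t \<in> {0<..<a}"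
      "f (u(i := u i + a, j := u j + a)) - f (u(i := u i + a)) - f (u(j := u j + a)) + f u = a * a * ?b (p (s, t))"
      using mixed_difference[OF f ij False a in1] unfolding p_def fst_conv snd_conv by metis
    obtain t' s' where st': "s' \<in> {0<..<a}" "t' \<in> {0<..<a}"
      "f (u(i := u i + a, j := u j + a)) - f (u(j := u j + a)) - f (u(i := u i + a)) + f u = a * a * ?a (p (s', t'))"
      using mixed_difference[OF f ij(2,1) False[symmetric] a in2] unfolding p_def fst_conv snd_conv sw by metis
    have "a * a * ?a (p (s', t')) = a * a * ?b (p (s, t))" using st(3) st'(3) by linarith
    then have "?a (p (s', t')) = ?b (p (s, t))" using a by simp
    moreover have "dist (?b (p (s, t))) (?b u) < \<epsilon>" "dist (?a (p (s', t'))) (?a u) < \<epsilon>"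
      using e(2) small st(1,2) st'(1,2) by auto
    moreover have "\<bar>?a u - ?b u\<bar> \<le> \<bar>r - ?b u\<bar> + \<bar>r - ?a u\<bar>" for r by linarith
    ultimately show False unfolding \<epsilon>_def dist_real_def by (smt (verit) field_sum_of_halves)
  qed
qed simp

text \<open>A derivative along the line is a linear combination of partial derivatives along the same line, so the
  chain rule iterates and the one-dimensional Taylor formula applies.\<close>

lemma taylor_along_line:
  assumes U: "openin (powertop_real {..<d}) U" and f: "C_on d 3 U f"
    and seg: "\<And>t. t \<in> {0..1} \<Longrightarrow> line d x h t \<in> U"
  obtains t where "t \<in> {0<..<1}"
    "f (line d x h 1) = f (line d x h 0) + (\<Sum>i<d. h i * partial i f (line d x h 0))
      + (\<Sum>i<d. \<Sum>j<d. h i * h j * partial i (partial j f) (line d x h 0)) / 2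
      + (\<Sum>i<d. \<Sum>j<d. \<Sum>l<d. h i * h j * h l * partial i (partial j (partial l f)) (line d x h t)) / 6"
proof -
  let ?l = "line d x h"
  define \<Phi> where "\<Phi> = (\<lambda>m::nat. if m = 0 then (\<lambda>t. f (?l t))
     else if m = 1 then (\<lambda>t. \<Sum>l<d. h l * partial l f (?l t))
     else if m = 2 then (\<lambda>t. \<Sum>l<d. h l * (\<Sum>j<d. h j * partial j (partial l f) (?l t)))
     else (\<lambda>t. \<Sum>l<d. h l * (\<Sum>j<d. h j * (\<Sum>i<d. h i * partial i (partial j (partial l f)) (?l t)))))"
  have f3: "C_on d (Suc (Suc (Suc 0))) U f" using f by (simp add: numeral_3_eq_3)
  have "DERIV (\<Phi> m) t :> \<Phi> (Suc m) t" if "m < 3" "0 \<le> t" "t \<le> 1" for m t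
  proof -
    have t: "?l t \<in> U" using seg that by simp
    have 1: "((\<lambda>t. f (?l t)) has_real_derivative (\<Sum>l<d. h l * partial l f (?l t))) (at t)"
      by (rule has_real_derivative_line[OF U f3 t])
    have 2: "((\<lambda>t. \<Sum>l<d. h l * partial l f (?l t)) has_real_derivative
        (\<Sum>l<d. h l * (\<Sum>j<d. h j * partial j (partial l f) (?l t)))) (at t)"
      by (intro DERIV_sum DERIV_cmult has_real_derivative_line[OF U C_on_partial[OF f3] t]) simp
    have 3: "((\<lambda>t. \<Sum>l<d. h l * (\<Sum>j<d. h j * partial j (partial l f) (?l t))) has_real_derivative
        (\<Sum>l<d. h l * (\<Sum>j<d. h j * (\<Sum>i<d. h i * partial i (partial j (partial l f)) (?l t))))) (at t)"
      by (intro DERIV_sum DERIV_cmult has_real_derivative_line[OF U C_on_partial[OF C_on_partial[OF f3]] t]) simp_all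
    consider "m = 0" | "m = 1" | "m = 2" using \<open>m < 3\<close> by linarith
    then show ?thesis by cases (use 1 2 3 in \<open>simp_all add: \<Phi>_def\<close>)
  qed
  then obtain t where t: "0 < t" "t < 1"
    "f (?l 1) = (\<Sum>m<3. \<Phi> m 0 / fact m * 1 ^ m) + \<Phi> 3 t / fact 3 * 1 ^ 3"
    using Maclaurin[of 1 3 \<Phi> "\<lambda>t. f (?l t)"] by (auto simp: \<Phi>_def)
  have s2: "\<Phi> 2 0 = (\<Sum>i<d. \<Sum>j<d. h i * h j * partial i (partial j f) (?l 0))"
    unfolding \<Phi>_def sum_distrib_left by (subst sum.swap) (simp add: ac_simps)
  have s3: "\<Phi> 3 t = (\<Sum>i<d. \<Sum>j<d. \<Sum>l<d. h i * h j * h l * partial i (partial j (partial l f)) (?l t))"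
  proof -
    have "\<Phi> 3 t = (\<Sum>l<d. \<Sum>j<d. \<Sum>i<d. h i * h j * h l * partial i (partial j (partial l f)) (?l t))"
      unfolding \<Phi>_def sum_distrib_left by (simp add: ac_simps)
    also have "\<dots> = (\<Sum>j<d. \<Sum>l<d. \<Sum>i<d. h i * h j * h l * partial i (partial j (partial l f)) (?l t))"
      by (rule sum.swap)
    also have "\<dots> = (\<Sum>j<d. \<Sum>i<d. \<Sum>l<d. h i * h j * h l * partial i (partial j (partial l f)) (?l t))"
      by (intro sum.cong refl sum.swap)
    also have "\<dots> = (\<Sum>i<d. \<Sum>j<d. \<Sum>l<d. h i * h j * h l * partial i (partial j (partial l f)) (?l t))"
      by (rule sum.swap)
    finally show ?thesis .
  qed
  have "f (?l 1) = \<Phi> 0 0 + \<Phi> 1 0 + \<Phi> 2 0 / 2 + \<Phi> 3 t / 6"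
    using t(3) by (simp add: lessThan_nat_numeral lessThan_Suc eval_nat_numeral)
  then show thesis using that[of t] t(1,2) unfolding s2 s3 by (simp add: \<Phi>_def)
qed


section \<open>Eigenvalue bounds for quadratic forms\<close>

text \<open>Vectors are extended by zero, so that the sphere is a closed subset of a product of compact intervals and
  Tychonoff's theorem applies.\<close>

lemma compact_unit_sphere_nat_fun:
  "compact {h :: nat \<Rightarrow> real. (\<forall>i\<ge>d. h i = 0) \<and> (\<Sum>i<d. (h i)\<^sup>2) = 1}"
proof -
  let ?B = "PiE UNIV (\<lambda>i. if i < d then {-1..1} else {0::real})"
  have "compactin (powertop_real UNIV) ?B"
    by (subst compactin_PiE) auto
  then have "compact ?B" by (simp add: euclidean_product_topology compactin_euclidean_iff)
  moreover have "closed {h :: nat \<Rightarrow> real. (\<Sum>i<d. (h i)\<^sup>2) = 1}"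
    by (intro closed_Collect_eq continuous_intros continuous_on_product_coordinates)
  ultimately have "compact (?B \<inter> {h. (\<Sum>i<d. (h i)\<^sup>2) = 1})" by (rule compact_Int_closed)
  moreover have "?B \<inter> {h. (\<Sum>i<d. (h i)\<^sup>2) = 1} = {h. (\<forall>i\<ge>d. h i = 0) \<and> (\<Sum>i<d. (h i)\<^sup>2) = 1}"
  proof -
    have "h \<in> ?B \<longleftrightarrow> (\<forall>i\<ge>d. h i = 0)" if "(\<Sum>i<d. (h i)\<^sup>2) = 1" for h :: "nat \<Rightarrow> real"
    proof -
      have "\<bar>h i\<bar> \<le> 1" if "i < d" for i
      proof -
        have "(h i)\<^sup>2 \<le> (\<Sum>i<d. (h i)\<^sup>2)" by (rule member_le_sum) (use that in auto)
        then show ?thesis using \<open>(\<Sum>i<d. (h i)\<^sup>2) = 1\<close> by (simp add: abs_square_le_1)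
      qed
      then have "h i \<in> (if i < d then {-1..1} else {0}) \<longleftrightarrow> (d \<le> i \<longrightarrow> h i = 0)" for i
        by (cases "i < d") (simp_all add: abs_le_iff minus_le_iff)
      then show ?thesis unfolding PiE_UNIV_domain Pi_iff by blast
    qed
    then show ?thesis by blast
  qed
  ultimately show ?thesis by simp
qed

lemma nonneg_linear_plus_quadratic:
  fixes b c :: real
  assumes "\<And>t. 0 \<le> 2 * t * b + t\<^sup>2 * c"
  shows "b = 0"
proof (rule ccontr)
  assume b: "b \<noteq> 0"
  have "0 \<le> 2 * (- b / (\<bar>c\<bar> + 1)) * b + (- b / (\<bar>c\<bar> + 1))\<^sup>2 * c" by (rule assms)
  also have "\<dots> = b\<^sup>2 / (\<bar>c\<bar> + 1)\<^sup>2 * (c - 2 * (\<bar>c\<bar> + 1))"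
    by (simp add: divide_simps) (simp add: power2_eq_square algebra_simps)
  also have "\<dots> < 0" using b by (intro mult_pos_neg) auto
  finally show False by simp
qed

text \<open>A minimizer \<open>v\<close> of the quadratic form \<open>q\<close> on the sphere exists by compactness; let \<open>e\<close> be the minimum. By
  homogeneity \<open>q h - e \<bar>h\<bar>\<^sup>2\<close> is nonnegative for all \<open>h\<close> and vanishes at \<open>v\<close>. Along
  \<open>v + t \<cdot> unit vector i\<close> it is a quadratic polynomial in \<open>t\<close> without constant term, and its linear
  coefficient, which is coordinate \<open>i\<close> of \<open>A v - e v\<close> up to the factor two, must be zero.\<close>

lemma least_rayleigh_quotient_eigenvector:
  fixes a :: "nat \<Rightarrow> nat \<Rightarrow> real"
  assumes "0 < d" and sym: "\<forall>i<d. \<forall>j<d. a i j = a j i"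
  shows "\<exists>v e. (\<exists>i<d. v i \<noteq> 0) \<and> (\<forall>i<d. (\<Sum>j<d. a i j * v j) = e * v i) \<and>
    (\<forall>h. e * (\<Sum>i<d. (h i)\<^sup>2) \<le> (\<Sum>i<d. \<Sum>j<d. h i * h j * a i j))"
proof -
  define q where "q h = (\<Sum>i<d. \<Sum>j<d. h i * h j * a i j)" for h
  define s where "s h = (\<Sum>i<d. (h i)\<^sup>2)" for h :: "nat \<Rightarrow> real"
  let ?K = "{h. (\<forall>i\<ge>d. h i = 0) \<and> (\<Sum>i<d. (h i)\<^sup>2) = (1::real)}"
  have "(\<lambda>i. if i = 0 then 1 else 0) \<in> ?K"
    using \<open>0 < d\<close> by (auto simp: if_distrib[where f = "\<lambda>x. x\<^sup>2"] sum.delta cong: if_cong)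
  then have "?K \<noteq> {}" by (rule ex_in_conv[THEN iffD1, OF exI])
  moreover have "continuous_on ?K q"
    unfolding q_def by (intro continuous_intros continuous_on_subset[OF continuous_on_product_coordinates]) auto
  ultimately have "\<exists>v\<in>?K. \<forall>h\<in>?K. q v \<le> q h"
    by (intro continuous_attains_inf compact_unit_sphere_nat_fun)
  then obtain v where v: "v \<in> ?K" "\<And>h. h \<in> ?K \<Longrightarrow> q v \<le> q h" by blast
  define e where "e = q v"
  have min: "e * s h \<le> q h" for h
  proof (cases "s h = 0")
    case True
    then have "h i = 0" if "i < d" for i
      using that by (auto simp: s_def sum_nonneg_eq_0_iff)
    then show ?thesis using True by (simp add: q_def)
  next
    case False
    then have pos: "0 < s h" by (simp add: s_def sum_nonneg less_le)
    define k where "k = (\<lambda>i. if i < d then h i / sqrt (s h) else 0)"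
    have "(\<Sum>i<d. (k i)\<^sup>2) = s h / s h"
      using pos by (simp add: k_def power_divide s_def[of h, symmetric] sum_divide_distrib[symmetric])
    then have "k \<in> ?K" using pos by (auto simp: k_def)
    then have "e \<le> q k" using v(2) by (simp add: e_def)
    also have "q k = q h / s h"
      using pos by (simp add: k_def q_def sum_divide_distrib real_sqrt_mult[symmetric])
    finally show ?thesis using pos by (simp add: field_simps)
  qed
  have sv: "s v = 1" using v(1) by (simp add: s_def)
  have ev: "(\<Sum>j<d. a i j * v j) = e * v i" if i: "i < d" for i
  proof -
    have "0 \<le> 2 * t * ((\<Sum>j<d. a i j * v j) - e * v i) + t\<^sup>2 * (a i i - e)" for t
    proof -
      let ?\<delta> = "\<lambda>j. if j = i then 1 else (0::real)"
      have "s (\<lambda>j. v j + t * ?\<delta> j) = (\<Sum>j<d. (v j)\<^sup>2 + (2 * t * v j * ?\<delta> j + t\<^sup>2 * ?\<delta> j))"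
        unfolding s_def by (intro sum.cong) (auto simp: power2_eq_square algebra_simps)
      also have "\<dots> = 1 + 2 * t * v i + t\<^sup>2"
        using i sv by (simp add: sum.distrib s_def if_distrib[of "(*) _"] cong: if_cong)
      finally have 1: "s (\<lambda>j. v j + t * ?\<delta> j) = 1 + 2 * t * v i + t\<^sup>2" .
      have "q (\<lambda>j. v j + t * ?\<delta> j) = (\<Sum>j<d. \<Sum>l<d. v j * v l * a j l + (t * (?\<delta> j * (v l * a j l))
          + (t * (?\<delta> l * (v j * a j l)) + t\<^sup>2 * (?\<delta> j * (?\<delta> l * a j l)))))"
        unfolding q_def by (intro sum.cong) (auto simp: power2_eq_square algebra_simps)
      also have "\<dots> = q v + (t * (\<Sum>j<d. ?\<delta> j * (\<Sum>l<d. v l * a j l))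
          + (t * (\<Sum>j<d. \<Sum>l<d. ?\<delta> l * (v j * a j l)) + t\<^sup>2 * (\<Sum>j<d. ?\<delta> j * (\<Sum>l<d. ?\<delta> l * a j l))))"
        by (simp only: sum.distrib sum_distrib_left q_def)
      also have "(\<Sum>j<d. ?\<delta> j * (\<Sum>l<d. v l * a j l)) = (\<Sum>l<d. v l * a i l)"
        using i by (simp add: if_distrib[of "\<lambda>x. x * _"] cong: if_cong)
      also have "(\<Sum>j<d. \<Sum>l<d. ?\<delta> l * (v j * a j l)) = (\<Sum>j<d. v j * a j i)"
        using i by (simp add: if_distrib[of "\<lambda>x. x * _"] cong: if_cong)
      also have "(\<Sum>j<d. v j * a j i) = (\<Sum>l<d. v l * a i l)"
        using i by (intro sum.cong) (auto simp: sym)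
      also have "(\<Sum>j<d. ?\<delta> j * (\<Sum>l<d. ?\<delta> l * a j l)) = a i i"
        using i by (simp add: if_distrib[of "\<lambda>x. x * _"] cong: if_cong)
      finally have 2: "q (\<lambda>j. v j + t * ?\<delta> j) = e + 2 * t * (\<Sum>l<d. a i l * v l) + t\<^sup>2 * a i i"
        by (simp add: e_def mult.commute)
      show ?thesis using min[of "\<lambda>j. v j + t * ?\<delta> j"] unfolding 1 2 by (simp add: algebra_simps)
    qed
    then show ?thesis using nonneg_linear_plus_quadratic by fastforce
  qed
  have "\<exists>i<d. v i \<noteq> 0"
  proof (rule ccontr)
    assume "\<not> (\<exists>i<d. v i \<noteq> 0)"
    then have "s v = 0" by (simp add: s_def)
    then show False using sv by simp
  qed
  then show ?thesis using ev min unfolding q_def s_def by blast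
qed

lemma eigenvalue_matI:
  fixes a :: "nat \<Rightarrow> nat \<Rightarrow> real"
  assumes "\<exists>i<d. v i \<noteq> 0" "\<And>i. i < d \<Longrightarrow> (\<Sum>j<d. a i j * v j) = e * v i"
  shows "eigenvalue (Matrix.mat d d (\<lambda>(i, j). a i j)) e"
proof -
  have "Matrix.vec d v \<noteq> 0\<^sub>v d" using assms(1) by (metis index_vec index_zero_vec(1))
  moreover have "Matrix.mat d d (\<lambda>(i, j). a i j) *\<^sub>v Matrix.vec d v = e \<cdot>\<^sub>v Matrix.vec d v"
    using assms(2) by (intro eq_vecI) (auto simp: scalar_prod_def lessThan_atLeast0)
  ultimately show ?thesis unfolding eigenvalue_def eigenvector_def by (intro exI[of _ "Matrix.vec d v"]) auto
qed

text \<open>The lower bound comes from the least Rayleigh quotient, which is an eigenvalue; the upper bound is the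
  same fact for the negated matrix.\<close>

lemma quadratic_form_eigenvalue_bounds:
  fixes a :: "nat \<Rightarrow> nat \<Rightarrow> real"
  assumes sym: "\<And>i j. i < d \<Longrightarrow> j < d \<Longrightarrow> a i j = a j i"
    and eig: "\<And>e. eigenvalue (Matrix.mat d d (\<lambda>(i, j). a i j)) e \<Longrightarrow> lo \<le> e \<and> e \<le> hi"
  shows "lo * (\<Sum>i<d. (h i)\<^sup>2) \<le> (\<Sum>i<d. \<Sum>j<d. h i * h j * a i j)"
    and "(\<Sum>i<d. \<Sum>j<d. h i * h j * a i j) \<le> hi * (\<Sum>i<d. (h i)\<^sup>2)"
proof -
  have s: "0 \<le> (\<Sum>i<d. (h i)\<^sup>2)" by (simp add: sum_nonneg)
  have "lo * (\<Sum>i<d. (h i)\<^sup>2) \<le> (\<Sum>i<d. \<Sum>j<d. h i * h j * a i j)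
      \<and> (\<Sum>i<d. \<Sum>j<d. h i * h j * a i j) \<le> hi * (\<Sum>i<d. (h i)\<^sup>2)"
  proof (cases "d = 0")
    case False
    then have d: "0 < d" by simp
    have "\<forall>i<d. \<forall>j<d. a i j = a j i" using sym by blast
    from least_rayleigh_quotient_eigenvector[OF d this]
    obtain v e where v: "\<exists>i<d. v i \<noteq> 0" "\<forall>i<d. (\<Sum>j<d. a i j * v j) = e * v i"
      "\<forall>h. e * (\<Sum>i<d. (h i)\<^sup>2) \<le> (\<Sum>i<d. \<Sum>j<d. h i * h j * a i j)"
      by (elim exE conjE) (rule that; (assumption | fast))
    have e: "lo \<le> e" using eig[OF eigenvalue_matI[OF v(1)]] v(2) by blast
    have "\<forall>i<d. \<forall>j<d. - a i j = - a j i" using sym by simp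
    from least_rayleigh_quotient_eigenvector[OF d this]
    obtain v' e' where v': "\<exists>i<d. v' i \<noteq> 0" "\<forall>i<d. (\<Sum>j<d. - a i j * v' j) = e' * v' i"
      "\<forall>h. e' * (\<Sum>i<d. (h i)\<^sup>2) \<le> (\<Sum>i<d. \<Sum>j<d. h i * h j * - a i j)"
      by (elim exE conjE) (rule that; (assumption | fast))
    have "(\<Sum>j<d. a i j * v' j) = - e' * v' i" if "i < d" for i
      using v'(2)[rule_format, OF that] by (simp add: sum_negf)
    then have e': "- e' \<le> hi" using eig[OF eigenvalue_matI[OF v'(1)]] by blast
    have "lo * (\<Sum>i<d. (h i)\<^sup>2) \<le> e * (\<Sum>i<d. (h i)\<^sup>2)" "- e' * (\<Sum>i<d. (h i)\<^sup>2) \<le> hi * (\<Sum>i<d. (h i)\<^sup>2)"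
      using e e' s by (intro mult_right_mono; simp)+
    then show ?thesis using v(3)[rule_format, of h] v'(3)[rule_format, of h] by (simp add: sum_negf)
  qed simp
  then show "lo * (\<Sum>i<d. (h i)\<^sup>2) \<le> (\<Sum>i<d. \<Sum>j<d. h i * h j * a i j)"
    and "(\<Sum>i<d. \<Sum>j<d. h i * h j * a i j) \<le> hi * (\<Sum>i<d. (h i)\<^sup>2)" by auto
qed


section \<open>Integration in a chart\<close>

text \<open>The integrand is a multiple of the density of the normal distribution with variance \<open>1 / (2 a)\<close>.\<close>

lemma nn_integral_gaussian:
  assumes "0 < (a::real)"
  shows "(\<integral>\<^sup>+t. ennreal (exp (- a * (t - b)\<^sup>2)) \<partial>lborel) = ennreal (sqrt (pi / a))"
proof -
  let ?\<sigma> = "1 / sqrt (2 * a)"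
  have "?\<sigma>\<^sup>2 = 1 / (2 * a)" using assms by (simp add: power_divide)
  then have "exp (- a * (t - b)\<^sup>2) = sqrt (pi / a) * normal_density b ?\<sigma> t" for t
    using assms by (simp add: normal_density_def mult.commute)
  moreover have "integrable lborel (\<lambda>t. sqrt (pi / a) * normal_density b ?\<sigma> t)"
    using assms by (intro integrable_mult_right integrable_normal_density) auto
  ultimately show ?thesis
    using assms by (simp add: nn_integral_eq_integral)
qed

lemma edist_square: "(edist d u x)\<^sup>2 = (\<Sum>i<d. (u i - x i)\<^sup>2)"
  by (simp add: edist_def L2_set_def sum_nonneg)

lemma edist_nonneg: "0 \<le> edist d u x"
  by (simp add: edist_def)

lemma borel_measurable_edist: "(\<lambda>u. edist d u x) \<in> borel_measurable (leb d)"
  unfolding edist_def L2_set_def by measurable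

lemma nn_integral_gaussian_leb:
  assumes "0 < a"
  shows "(\<integral>\<^sup>+u. ennreal (exp (- a * (edist d u x)\<^sup>2)) \<partial>leb d) = ennreal (sqrt (pi / a) ^ d)"
proof -
  interpret product_sigma_finite "\<lambda>_::nat. lborel :: real measure" ..
  have "ennreal (exp (- a * (edist d u x)\<^sup>2)) = (\<Prod>i<d. ennreal (exp (- a * (u i - x i)\<^sup>2)))" for u
    by (simp add: edist_square sum_distrib_left exp_sum[symmetric] sum_negf prod_ennreal)
  then have "(\<integral>\<^sup>+u. ennreal (exp (- a * (edist d u x)\<^sup>2)) \<partial>leb d)
      = (\<Prod>i<d. \<integral>\<^sup>+t. ennreal (exp (- a * (t - x i)\<^sup>2)) \<partial>lborel)"
    by (simp only:) (rule product_nn_integral_prod; measurable)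
  also have "\<dots> = (\<Prod>i<d. ennreal (sqrt (pi / a)))"
    by (simp only: nn_integral_gaussian[OF assms])
  also have "\<dots> = ennreal (sqrt (pi / a) ^ d)" by (simp add: ennreal_power assms less_imp_le)
  finally show ?thesis .
qed

text \<open>Lower bounds for integrals only need a set of known volume inside the ball of radius \<open>d s\<close>; the cube
  of half-side \<open>s\<close> makes its product measure immediate.\<close>

definition cube :: "nat \<Rightarrow> (nat \<Rightarrow> real) \<Rightarrow> real \<Rightarrow> (nat \<Rightarrow> real) set" where
  "cube d x s = PiE {..<d} (\<lambda>i. {x i - s <..< x i + s})"

lemma sets_cube: "cube d x s \<in> sets (leb d)"
  unfolding cube_def by (intro sets_PiM_I_finite) auto

lemma emeasure_cube:
  assumes "0 \<le> s"
  shows "emeasure (leb d) (cube d x s) = ennreal ((2 * s) ^ d)"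
proof -
  interpret product_sigma_finite "\<lambda>_::nat. lborel :: real measure" ..
  have "emeasure (leb d) (cube d x s) = (\<Prod>i<d. emeasure lborel {x i - s <..< x i + s})"
    unfolding cube_def by (rule emeasure_PiM) auto
  also have "\<dots> = ennreal ((2 * s) ^ d)" using assms by (simp add: ennreal_power)
  finally show ?thesis .
qed

lemma edist_cube_le: "u \<in> cube d x s \<Longrightarrow> edist d u x \<le> real d * s"
proof -
  assume u: "u \<in> cube d x s"
  have "edist d u x \<le> (\<Sum>i<d. \<bar>u i - x i\<bar>)" unfolding edist_def by (rule L2_set_le_sum_abs)
  also have "\<dots> \<le> (\<Sum>i<d. s)"
  proof (rule sum_mono)
    fix i assume "i \<in> {..<d}"
    then have "u i \<in> {x i - s <..< x i + s}" using u unfolding cube_def by blast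
    then show "\<bar>u i - x i\<bar> \<le> s" by auto
  qed
  finally show ?thesis by simp
qed

text \<open>A chart of the parameter manifold together with the density \<open>w\<close> of the reference measure in it. The lemmas
  \<open>nn_integral_ge_cube\<close> and \<open>nn_integral_le_gaussian\<close> bound integrals over the whole manifold from below
  and above by explicit integrals over \<open>\<real>\<^sup>d\<close>.\<close>

locale measured_chart =
  fixes d :: nat and \<Theta> :: "'p::{second_countable_topology, t2_space} set" and \<mu> :: "'p measure"
    and V :: "'p set" and \<psi> :: "'p \<Rightarrow> nat \<Rightarrow> real" and w :: "(nat \<Rightarrow> real) \<Rightarrow> real"
  assumes V_open: "openin (top_of_set \<Theta>) V"
    and image_open: "openin (powertop_real {..<d}) (\<psi> ` V)"
    and homeo: "homeomorphic_map (top_of_set V) (subtopology (powertop_real {..<d}) (\<psi> ` V)) \<psi>"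
    and sets_vol: "sets \<mu> = sets (restrict_space borel \<Theta>)"
    and density: "coord_density d \<mu> V \<psi> w"
begin

lemma image_subset: "\<psi> ` V \<subseteq> PiE {..<d} (\<lambda>_. UNIV)"
  using openin_subset[OF image_open] by simp

lemma space_vol: "space \<mu> = \<Theta>"
  using sets_eq_imp_space_eq[OF sets_vol] by (simp add: space_restrict_space)

lemma sets_chart: "V \<in> sets \<mu>"
proof -
  obtain G where "open G" "V = \<Theta> \<inter> G" using V_open unfolding openin_open by blast
  then show ?thesis unfolding sets_vol sets_restrict_space by (intro image_eqI[of _ _ G] borel_open)
qed

lemma chart_subset: "V \<subseteq> \<Theta>"
  using openin_subset[OF V_open] by simp

lemma inj_chart: "inj_on \<psi> V"
  using homeomorphic_imp_injective_map[OF homeo] by simp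

lemma weight_pos: "u \<in> \<psi> ` V \<Longrightarrow> 0 < w u"
  using density by (auto simp: coord_density_def)

lemma continuous_on_chart: "continuous_on V \<psi>"
  using homeomorphic_imp_continuous_map[OF homeo]
  unfolding topology_open_subset[OF openin_subset[OF image_open]] by (simp add: continuous_map_in_subtopology)

lemma sets_restrict_chart: "sets (restrict_space \<mu> V) = sets (restrict_space borel V)"
  using sets_restrict_space_cong[OF sets_vol, of V] chart_subset
  by (simp add: sets_restrict_restrict_space Int_absorb1)

lemma measurable_chart: "\<psi> \<in> measurable (restrict_space \<mu> V) (leb d)"
proof -
  have "\<psi> \<in> measurable (restrict_space borel V) (restrict_space borel (PiE {..<d} (\<lambda>_. UNIV)))"
    using borel_measurable_continuous_on_restrict[OF continuous_on_chart] image_subset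
    by (intro measurable_restrict_space2) (auto simp: space_restrict_space)
  then show ?thesis
    by (simp add: measurable_cong_sets[OF sets_restrict_chart sets_leb])
qed

lemma sets_image: "\<psi> ` V \<in> sets (leb d)"
proof -
  obtain G where G: "open G" "\<psi> ` V = PiE {..<d} (\<lambda>_. UNIV) \<inter> G"
    using openin_powertop_imp_relative_open[OF image_open] .
  then show ?thesis unfolding sets_leb sets_restrict_space by (intro image_eqI[of _ _ G] borel_open)
qed

lemma borel_measurable_weight: "(\<lambda>u. indicator (\<psi> ` V) u * w u) \<in> borel_measurable (leb d)"
proof -
  have "C_on d 0 (\<psi> ` V) w" using density by (auto simp: coord_density_def simp del: C_on.simps)
  then have "continuous_on (\<psi> ` V) w"
    by (rule continuous_on_of_C_on[OF image_open])
  then have "w \<in> borel_measurable (restrict_space borel (\<psi> ` V))"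
    by (rule borel_measurable_continuous_on_restrict)
  moreover have "sets (restrict_space (leb d) (\<psi> ` V)) = sets (restrict_space borel (\<psi> ` V))"
    using sets_restrict_space_cong[OF sets_leb, where \<Omega> = "\<psi> ` V"] image_subset
    by (simp only: sets_restrict_restrict_space Int_absorb1)
  ultimately have "w \<in> borel_measurable (restrict_space (leb d) (\<psi> ` V))"
    by (simp cong: measurable_cong_sets)
  then show ?thesis
    using sets_image by (subst (asm) borel_measurable_restrict_space_iff) (auto simp: sets.Int_space_eq2)
qed

text \<open>The measure \<open>\<mu>\<close> has density \<open>w\<close> in the chart, so dividing by \<open>w\<close> turns an integral over the
  chart domain into a plain Lebesgue integral over its image.\<close>

lemma
  assumes k: "k \<in> borel_measurable (leb d)" "\<And>u. 0 \<le> k u"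
  shows borel_measurable_pullback:
      "(\<lambda>\<theta>. ennreal (k (\<psi> \<theta>) / w (\<psi> \<theta>)) * indicator V \<theta>) \<in> borel_measurable \<mu>" (is ?meas)
    and nn_integral_pullback:
      "(\<integral>\<^sup>+\<theta>. ennreal (k (\<psi> \<theta>) / w (\<psi> \<theta>)) * indicator V \<theta> \<partial>\<mu>) =
       (\<integral>\<^sup>+u. ennreal (k u) * indicator (\<psi> ` V) u \<partial>leb d)" (is ?int)
proof -
  \<comment> \<open>The density \<open>w\<close> is arbitrary outside the chart image, hence the cut-off to get a measurable function.\<close>
  let ?w = "\<lambda>u. indicator (\<psi> ` V) u * w u"
  let ?h = "\<lambda>u. ennreal (k u / ?w u)"
  have h: "?h \<in> borel_measurable (leb d)"
    by (intro measurable_compose[OF _ measurable_ennreal] borel_measurable_divide k(1) borel_measurable_weight)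
  have eq: "ennreal (k (\<psi> \<theta>) / w (\<psi> \<theta>)) = ?h (\<psi> \<theta>)" if "\<theta> \<in> V" for \<theta>
    using that by simp
  have V: "V \<inter> space \<mu> \<in> sets \<mu>" using sets_chart by auto
  have "(\<lambda>\<theta>. ?h (\<psi> \<theta>)) \<in> borel_measurable (restrict_space \<mu> V)"
    using measurable_compose[OF measurable_chart h] .
  then have "(\<lambda>\<theta>. ?h (\<psi> \<theta>) * indicator V \<theta>) \<in> borel_measurable \<mu>"
    by (rule iffD1[OF borel_measurable_restrict_space_iff_ennreal[OF V]])
  moreover have ext: "(\<lambda>\<theta>. ennreal (k (\<psi> \<theta>) / w (\<psi> \<theta>)) * indicator V \<theta>) = (\<lambda>\<theta>. ?h (\<psi> \<theta>) * indicator V \<theta>)"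
    using eq by (auto simp: indicator_def)
  ultimately show ?meas by simp
  have "(\<integral>\<^sup>+\<theta>. ?h (\<psi> \<theta>) * indicator V \<theta> \<partial>\<mu>) = (\<integral>\<^sup>+\<theta>. ?h (\<psi> \<theta>) \<partial>restrict_space \<mu> V)"
    by (rule nn_integral_restrict_space[OF V, symmetric])
  also have "\<dots> = (\<integral>\<^sup>+u. ?h u \<partial>distr (restrict_space \<mu> V) (leb d) \<psi>)"
    by (rule nn_integral_distr[OF measurable_chart, symmetric]) (simp add: h)
  also have "\<dots> = (\<integral>\<^sup>+u. ?h u \<partial>density (leb d) (\<lambda>u. ennreal (?w u)))"
    using density by (simp add: coord_density_def)
  also have "\<dots> = (\<integral>\<^sup>+u. ennreal (?w u) * ?h u \<partial>leb d)"
    by (intro nn_integral_density measurable_compose[OF borel_measurable_weight measurable_ennreal] h)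
  also have "\<dots> = (\<integral>\<^sup>+u. ennreal (k u) * indicator (\<psi> ` V) u \<partial>leb d)"
  proof (rule nn_integral_cong)
    fix u
    show "ennreal (?w u) * ?h u = ennreal (k u) * indicator (\<psi> ` V) u"
    proof (cases "u \<in> \<psi> ` V")
      case True
      with weight_pos[OF True] show ?thesis by (simp add: ennreal_mult'[symmetric])
    qed simp
  qed
  finally show ?int unfolding ext .
qed

lemma nn_integral_ge_cube:
  assumes s: "0 \<le> s" and m: "0 \<le> m" and sub: "cube d x s \<subseteq> \<psi> ` V"
    and h: "\<And>\<theta>. \<theta> \<in> V \<Longrightarrow> \<psi> \<theta> \<in> cube d x s \<Longrightarrow> m \<le> h \<theta> * w (\<psi> \<theta>)"
  shows "ennreal (m * (2 * s) ^ d) \<le> (\<integral>\<^sup>+\<theta>. ennreal (h \<theta>) \<partial>\<mu>)"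
proof -
  let ?k = "\<lambda>u. m * indicator (cube d x s) u"
  have k: "?k \<in> borel_measurable (leb d)"
    by (rule borel_measurable_times[OF borel_measurable_const borel_measurable_indicator[OF sets_cube]])
  have k0: "0 \<le> ?k u" for u using m by simp
  have "ennreal (m * (2 * s) ^ d) = (\<integral>\<^sup>+u. ennreal m * indicator (cube d x s) u \<partial>leb d)"
    using s m by (simp add: nn_integral_cmult_indicator[OF sets_cube] emeasure_cube ennreal_mult)
  also have "\<dots> = (\<integral>\<^sup>+u. ennreal (?k u) * indicator (\<psi> ` V) u \<partial>leb d)"
    using sub by (intro nn_integral_cong) (auto simp: indicator_def subset_iff)
  also have "\<dots> = (\<integral>\<^sup>+\<theta>. ennreal (?k (\<psi> \<theta>) / w (\<psi> \<theta>)) * indicator V \<theta> \<partial>\<mu>)"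
    by (rule nn_integral_pullback[OF k k0, symmetric])
  also have "\<dots> \<le> (\<integral>\<^sup>+\<theta>. ennreal (h \<theta>) \<partial>\<mu>)"
  proof (rule nn_integral_mono)
    fix \<theta>
    show "ennreal (?k (\<psi> \<theta>) / w (\<psi> \<theta>)) * indicator V \<theta> \<le> ennreal (h \<theta>)"
    proof (cases "\<theta> \<in> V \<and> \<psi> \<theta> \<in> cube d x s")
      case True
      then show ?thesis using h[of \<theta>] weight_pos[of "\<psi> \<theta>"]
        by (auto intro!: ennreal_leI simp: field_simps)
    qed (auto simp: indicator_def)
  qed
  finally show ?thesis .
qed

text \<open>The two alternatives for \<open>h\<close> are meant for the region far from a maximizer, where a likelihood ratio is at
  most \<open>\<epsilon>\<close> and the prior \<open>p\<close> has total mass one, and for the region near it, where the likelihood has a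
  Gaussian majorant in coordinates.\<close>

lemma nn_integral_le_gaussian:
  assumes a: "0 < a" and m: "0 \<le> m" and \<epsilon>: "0 \<le> \<epsilon>"
    and p: "p \<in> borel_measurable \<mu>" "\<And>\<theta>. \<theta> \<in> \<Theta> \<Longrightarrow> 0 \<le> p \<theta>" "(\<integral>\<^sup>+\<theta>. ennreal (p \<theta>) \<partial>\<mu>) = 1"
    and h: "\<And>\<theta>. \<theta> \<in> \<Theta> \<Longrightarrow> h \<theta> \<le> \<epsilon> * p \<theta> \<or>
      (\<theta> \<in> V \<and> h \<theta> * w (\<psi> \<theta>) \<le> m * exp (- a * (edist d (\<psi> \<theta>) x)\<^sup>2))"
  shows "(\<integral>\<^sup>+\<theta>. ennreal (h \<theta>) \<partial>\<mu>) \<le> ennreal (\<epsilon> + m * sqrt (pi / a) ^ d)"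
proof -
  let ?k = "\<lambda>u. m * exp (- a * (edist d u x)\<^sup>2)"
  have gauss: "(\<lambda>u. exp (- a * (edist d u x)\<^sup>2)) \<in> borel_measurable (leb d)"
    using measurable_compose[OF borel_measurable_edist, of "\<lambda>t. exp (- a * t\<^sup>2)" borel] by simp
  then have k: "?k \<in> borel_measurable (leb d)" by (intro borel_measurable_times borel_measurable_const)
  have k0: "0 \<le> ?k u" for u using m by simp
  let ?q = "\<lambda>\<theta>. ennreal (?k (\<psi> \<theta>) / w (\<psi> \<theta>)) * indicator V \<theta>"
  have "(\<integral>\<^sup>+\<theta>. ennreal (h \<theta>) \<partial>\<mu>) \<le> (\<integral>\<^sup>+\<theta>. ennreal \<epsilon> * ennreal (p \<theta>) + ?q \<theta> \<partial>\<mu>)"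
  proof (rule nn_integral_mono)
    fix \<theta> assume "\<theta> \<in> space \<mu>"
    then have \<theta>: "\<theta> \<in> \<Theta>" by (simp add: space_vol)
    from h[OF \<theta>] show "ennreal (h \<theta>) \<le> ennreal \<epsilon> * ennreal (p \<theta>) + ?q \<theta>"
    proof
      assume "h \<theta> \<le> \<epsilon> * p \<theta>"
      then have "ennreal (h \<theta>) \<le> ennreal \<epsilon> * ennreal (p \<theta>)"
        using p(2)[OF \<theta>] \<epsilon> by (simp add: ennreal_mult[symmetric] ennreal_leI)
      then show ?thesis by (rule order_trans) simp
    next
      assume *: "\<theta> \<in> V \<and> h \<theta> * w (\<psi> \<theta>) \<le> ?k (\<psi> \<theta>)"
      then have "h \<theta> \<le> ?k (\<psi> \<theta>) / w (\<psi> \<theta>)"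
        using weight_pos[of "\<psi> \<theta>"] by (simp add: pos_le_divide_eq)
      then have "ennreal (h \<theta>) \<le> ?q \<theta>" using * by (simp add: ennreal_leI)
      then show ?thesis by (rule order_trans) simp
    qed
  qed
  also have "\<dots> = (\<integral>\<^sup>+\<theta>. ennreal \<epsilon> * ennreal (p \<theta>) \<partial>\<mu>) + (\<integral>\<^sup>+\<theta>. ?q \<theta> \<partial>\<mu>)"
    by (intro nn_integral_add borel_measurable_pullback[OF k k0] borel_measurable_times_ennreal
        borel_measurable_const measurable_compose[OF p(1) measurable_ennreal])
  also have "(\<integral>\<^sup>+\<theta>. ennreal \<epsilon> * ennreal (p \<theta>) \<partial>\<mu>) = ennreal \<epsilon>"
    using p(1,3) by (subst nn_integral_cmult) auto
  also have "(\<integral>\<^sup>+\<theta>. ?q \<theta> \<partial>\<mu>) = (\<integral>\<^sup>+u. ennreal (?k u) * indicator (\<psi> ` V) u \<partial>leb d)"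
    by (rule nn_integral_pullback[OF k k0])
  also have "\<dots> \<le> (\<integral>\<^sup>+u. ennreal m * ennreal (exp (- a * (edist d u x)\<^sup>2)) \<partial>leb d)"
    using m by (intro nn_integral_mono) (auto simp: indicator_def ennreal_mult)
  also have "\<dots> = ennreal m * (\<integral>\<^sup>+u. ennreal (exp (- a * (edist d u x)\<^sup>2)) \<partial>leb d)"
    by (intro nn_integral_cmult measurable_compose[OF gauss measurable_ennreal])
  also have "\<dots> = ennreal (m * sqrt (pi / a) ^ d)"
    unfolding nn_integral_gaussian_leb[OF a] using m a by (simp add: ennreal_mult)
  finally show ?thesis using \<epsilon> m a by (simp add: add_left_mono ennreal_plus[symmetric] del: ennreal_plus)
qed

end


section \<open>Laplace bounds for a single integral\<close>

text \<open>Cauchy--Schwarz over index triples: the tensor \<open>h \<otimes> h \<otimes> h\<close> has Hilbert--Schmidt norm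
  \<open>\<bar>h\<bar>\<^sup>3\<close>.\<close>

lemma third_order_term_bound:
  "\<bar>\<Sum>i<d. \<Sum>j<d. \<Sum>l<d. h i * h j * h l * partial i (partial j (partial l f)) u\<bar>
     \<le> L2_set h {..<d} ^ 3 * norm_deriv3 d f u"
proof -
  let ?A = "{..<d} \<times> {..<d} \<times> {..<d}"
  let ?h = "\<lambda>(i, j, l). h i * h j * h l"
  let ?P = "\<lambda>(i, j, l). partial i (partial j (partial l f)) u"
  have "(\<Sum>i<d. \<Sum>j<d. \<Sum>l<d. h i * h j * h l * partial i (partial j (partial l f)) u)
      = (\<Sum>p\<in>?A. ?h p * ?P p)"
    by (simp add: sum.cartesian_product case_prod_unfold)
  also have "\<bar>\<dots>\<bar> \<le> (\<Sum>p\<in>?A. \<bar>?h p\<bar> * \<bar>?P p\<bar>)"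
    by (rule order_trans[OF sum_abs]) (simp add: abs_mult)
  also have "\<dots> \<le> L2_set ?h ?A * L2_set ?P ?A" by (rule L2_set_mult_ineq)
  also have "L2_set ?h ?A = L2_set h {..<d} ^ 3"
  proof -
    have "(\<Sum>p\<in>?A. (?h p)\<^sup>2) = (\<Sum>i<d. \<Sum>j<d. \<Sum>l<d. (h i)\<^sup>2 * ((h j)\<^sup>2 * (h l)\<^sup>2))"
      by (simp add: sum.cartesian_product case_prod_unfold power_mult_distrib mult.assoc)
    also have "\<dots> = (\<Sum>i<d. (h i)\<^sup>2) ^ 3"
      by (simp add: sum_distrib_left[symmetric] sum_distrib_right[symmetric] power3_eq_cube mult.assoc)
    finally show ?thesis by (simp add: L2_set_def real_sqrt_power)
  qed
  finally show ?thesis by (simp add: norm_deriv3_def)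
qed

text \<open>Third order Taylor expansion along the segment from the maximizer \<open>x\<close> to \<open>u\<close>. The first order term
  vanishes since \<open>t = 0\<close> is an interior maximum of the function along the line, the second order term is
  controlled by the eigenvalues of the negative Hessian, which is symmetric because mixed partial derivatives
  commute, and the third order term is evaluated at an intermediate point of the segment, which stays in
  the ball.\<close>

lemma taylor_at_maximizer:
  assumes U: "openin (powertop_real {..<d}) U" and f: "C_on d 3 U f" and x: "x \<in> U"
    and max: "\<And>u. u \<in> U \<Longrightarrow> f u \<le> f x"
    and eig: "\<And>e. eigenvalue (neg_hessian d f x) e \<Longrightarrow> lo \<le> e \<and> e \<le> hi"
    and ball: "\<And>u. u \<in> PiE {..<d} (\<lambda>_. UNIV) \<Longrightarrow> edist d u x \<le> \<rho> \<Longrightarrow> u \<in> U \<and> norm_deriv3 d f u \<le> L"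
    and u: "u \<in> PiE {..<d} (\<lambda>_. UNIV)" "edist d u x \<le> \<rho>"
  shows "f u \<le> f x - lo / 2 * (edist d u x)\<^sup>2 + L / 6 * edist d u x ^ 3"
    and "f x - hi / 2 * (edist d u x)\<^sup>2 - L / 6 * edist d u x ^ 3 \<le> f u"
proof -
  let ?h = "\<lambda>i. u i - x i"
  let ?e = "edist d u x"
  have xP: "x \<in> PiE {..<d} (\<lambda>_. UNIV)" using openin_subset[OF U] x by auto
  have line0: "line d x ?h 0 = x" and line1: "line d x ?h 1 = u"
    using xP u(1) by (auto simp: line_def PiE_iff extensional_def)
  have dist: "edist d (line d x ?h t) x = \<bar>t\<bar> * ?e" for t
  proof -
    have "edist d (line d x ?h t) x = L2_set (\<lambda>i. \<bar>t\<bar> * ?h i) {..<d}"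
      by (simp add: edist_def line_def L2_set_def power_mult_distrib)
    then show ?thesis by (simp add: L2_set_right_distrib edist_def)
  qed
  have seg: "line d x ?h t \<in> U \<and> norm_deriv3 d f (line d x ?h t) \<le> L" if "\<bar>t\<bar> \<le> 1" for t
  proof (rule ball)
    show "line d x ?h t \<in> PiE {..<d} (\<lambda>_. UNIV)" by (simp add: line_def)
    have "\<bar>t\<bar> * ?e \<le> 1 * ?e" using that by (intro mult_right_mono edist_nonneg)
    then show "edist d (line d x ?h t) x \<le> \<rho>" using u(2) by (simp add: dist)
  qed
  have f3: "C_on d (Suc (Suc (Suc 0))) U f" using f by (simp only: numeral_3_eq_3)
  have grad: "(\<Sum>i<d. ?h i * partial i f x) = 0"
  proof -
    have "((\<lambda>t. f (line d x ?h t)) has_real_derivative (\<Sum>i<d. ?h i * partial i f (line d x ?h 0))) (at 0)"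
      by (rule has_real_derivative_line[OF U f3]) (simp only: line0 x)
    moreover have "f (line d x ?h t) \<le> f (line d x ?h 0)" if "\<bar>0 - t\<bar> < 1" for t
      using max seg[of t] that by (simp add: line0)
    ultimately show ?thesis using DERIV_local_max[of _ _ 0 1] by (simp add: line0)
  qed
  obtain t where t: "t \<in> {0<..<1}" and
    "f (line d x ?h 1) = f (line d x ?h 0) + (\<Sum>i<d. ?h i * partial i f (line d x ?h 0))
      + (\<Sum>i<d. \<Sum>j<d. ?h i * ?h j * partial i (partial j f) (line d x ?h 0)) / 2
      + (\<Sum>i<d. \<Sum>j<d. \<Sum>l<d. ?h i * ?h j * ?h l * partial i (partial j (partial l f)) (line d x ?h t)) / 6"
    by (rule taylor_along_line[OF U f, of x ?h]) (use seg in auto)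
  then have eq: "f u = f x - (\<Sum>i<d. \<Sum>j<d. ?h i * ?h j * (- partial i (partial j f) x)) / 2
      + (\<Sum>i<d. \<Sum>j<d. \<Sum>l<d. ?h i * ?h j * ?h l * partial i (partial j (partial l f)) (line d x ?h t)) / 6"
    (is "_ = _ - ?Q / 2 + ?T / 6")
    by (simp add: line0 line1 grad sum_negf)
  have "\<bar>?T\<bar> \<le> ?e ^ 3 * norm_deriv3 d f (line d x ?h t)"
    using third_order_term_bound unfolding edist_def .
  also have "\<dots> \<le> ?e ^ 3 * L"
    using seg[of t] t by (intro mult_left_mono) (auto simp: edist_nonneg)
  finally have T: "\<bar>?T\<bar> \<le> L * ?e ^ 3" by (simp add: mult.commute)
  have sym: "- partial i (partial j f) x = - partial j (partial i f) x" if "i < d" "j < d" for i j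
    using partial_commute[OF U f3 that x] by simp
  note Q = quadratic_form_eigenvalue_bounds[of d "\<lambda>i j. - partial i (partial j f) x", OF sym
      eig[unfolded neg_hessian_def], of ?h, folded edist_square]
  show "f u \<le> f x - lo / 2 * ?e\<^sup>2 + L / 6 * ?e ^ 3" using eq T Q(1) by (simp add: abs_le_iff)
  show "f x - hi / 2 * ?e\<^sup>2 - L / 6 * ?e ^ 3 \<le> f u" using eq T Q(2) by (simp add: abs_le_iff)
qed

text \<open>This makes the contribution of the region far from the maximizer, which decays exponentially in the sample
  size, harmless after multiplication by the power of the sample size in the Laplace normalization.\<close>

lemma power_le_exp:
  fixes \<gamma> t :: real
  assumes "0 < \<gamma>" "0 \<le> t"
  shows "t ^ D \<le> (real (Suc D) / \<gamma>) ^ D * exp (\<gamma> * t)"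
proof -
  let ?c = "real (Suc D) / \<gamma>"
  have "t / ?c \<le> exp (t / ?c)" using exp_ge_add_one_self[of "t / ?c"] by linarith
  then have "t \<le> ?c * exp (t / ?c)" using assms by (simp add: field_simps)
  then have "t ^ D \<le> (?c * exp (t / ?c)) ^ D" using assms by (intro power_mono)
  also have "\<dots> = ?c ^ D * exp (real D * (t / ?c))" by (simp only: power_mult_distrib exp_of_nat_mult)
  also have "\<dots> \<le> ?c ^ D * exp (\<gamma> * t)"
  proof -
    have "real D * (t / ?c) = \<gamma> * t * (real D / real (Suc D))" using assms by (simp add: field_simps)
    also have "\<dots> \<le> \<gamma> * t * 1" using assms by (intro mult_left_mono) auto
    finally show ?thesis using assms by (intro mult_left_mono) auto
  qed
  finally show ?thesis .
qed

lemma min_one_power_le: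
  fixes q :: real
  assumes "0 < q" "d \<le> D"
  shows "min 1 q ^ D \<le> q ^ d"
proof -
  have "min 1 q ^ D \<le> min 1 q ^ d" using assms by (intro power_decreasing) auto
  also have "\<dots> \<le> q ^ d" using assms by (intro power_mono) auto
  finally show ?thesis .
qed

lemma le_max_one_power:
  fixes q :: real
  assumes "0 \<le> q" "d \<le> D"
  shows "q ^ d \<le> max 1 q ^ D"
proof -
  have "q ^ d \<le> max 1 q ^ d" using assms by (intro power_mono) auto
  also have "\<dots> \<le> max 1 q ^ D" using assms by (intro power_increasing) auto
  finally show ?thesis .
qed

text \<open>Bounds for the normalized Laplace integral that depend on the model only through a dimension bound
  \<open>D\<close>, the radius \<open>\<rho>\<close> on which the quadratic bounds hold, the curvature bounds \<open>c\<close>, \<open>B\<close>, the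
  separation \<open>\<gamma>\<close> and the lower bound \<open>a\<close> for the prior density at the maximizer. The
  truncations at \<open>1\<close> make the powers monotone in the exponent, so that \<open>D\<close> serves all dimensions
  \<open>d \<le> D\<close>. That the sample size does not occur is the point of Laplace's method.\<close>

definition laplace_lower :: "nat \<Rightarrow> real \<Rightarrow> real \<Rightarrow> real \<Rightarrow> real" where
  "laplace_lower D \<rho> B a = exp (- B * \<rho>\<^sup>2) * (a / 2) * min 1 (2 * \<rho> / (real D + 1)) ^ D"

definition laplace_upper :: "nat \<Rightarrow> real \<Rightarrow> real \<Rightarrow> real \<Rightarrow> real" where
  "laplace_upper D \<rho> c \<gamma> = (real (Suc D) / \<gamma>) ^ D
     + 3 / min 1 (2 * \<rho> / (real D + 1)) ^ D * max 1 (sqrt (pi / c)) ^ D"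

context measured_chart begin

text \<open>Write \<open>x\<close> for the maximizer in coordinates and \<open>n\<close> for the sample size. For the lower bound, on the
  cube of half-side of order \<open>1 / \<surd>n\<close> the log-likelihood drops by at most a constant and the prior density is
  at least half its value at \<open>x\<close>, while the cube has volume of order \<open>n\<^sup>-\<^sup>d\<^sup>/\<^sup>2\<close>. For the upper
  bound, the integrand is dominated by a Gaussian with variance of order \<open>1 / n\<close> near \<open>x\<close>, and it is
  exponentially small relative to the prior elsewhere.

  The hypotheses bound the prior density \<open>g0\<close> at \<open>x\<close> only from below. It is bounded above since the prior
  has total mass one and puts at least \<open>g0 / 2\<close> times the volume of a fixed cube on that cube.\<close>

lemma laplace_integral_bounds:
  fixes l p :: "'p \<Rightarrow> real" and N :: nat
  assumes l: "l \<in> borel_measurable \<mu>" and p: "proper_density \<mu> p"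
    and \<theta>: "\<theta> \<in> V" and max: "\<And>\<theta>'. \<theta>' \<in> \<Theta> \<Longrightarrow> l \<theta>' \<le> l \<theta>"
    and D: "d \<le> D" and N: "1 \<le> N" and pos: "0 < \<rho>" "0 < c" "0 < B" "0 < \<gamma>" "0 < a" "a \<le> g0"
    and ball: "\<And>u. u \<in> PiE {..<d} (\<lambda>_. UNIV) \<Longrightarrow> edist d u (\<psi> \<theta>) \<le> \<rho> \<Longrightarrow> u \<in> \<psi> ` V"
    and lo: "\<And>\<theta>'. \<theta>' \<in> V \<Longrightarrow> edist d (\<psi> \<theta>') (\<psi> \<theta>) \<le> \<rho> \<Longrightarrow>
      l \<theta> - B * real N * (edist d (\<psi> \<theta>') (\<psi> \<theta>))\<^sup>2 \<le> l \<theta>'"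
    and hi: "\<And>\<theta>'. \<theta>' \<in> V \<Longrightarrow> edist d (\<psi> \<theta>') (\<psi> \<theta>) \<le> \<rho> \<Longrightarrow>
      l \<theta>' \<le> l \<theta> - c * real N * (edist d (\<psi> \<theta>') (\<psi> \<theta>))\<^sup>2"
    and g: "\<And>\<theta>'. \<theta>' \<in> V \<Longrightarrow> edist d (\<psi> \<theta>') (\<psi> \<theta>) \<le> \<rho> \<Longrightarrow>
      g0 / 2 \<le> p \<theta>' * w (\<psi> \<theta>') \<and> p \<theta>' * w (\<psi> \<theta>') \<le> 3 / 2 * g0"
    and far: "\<And>\<theta>'. \<theta>' \<in> far d \<Theta> V \<psi> \<theta> \<rho> \<Longrightarrow> l \<theta>' \<le> l \<theta> - \<gamma> * real N"
  shows "laplace_lower D \<rho> B a \<le> (\<integral>\<theta>'. exp (l \<theta>' - l \<theta>) * p \<theta>' \<partial>\<mu>) * sqrt (real N) ^ d"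
    and "(\<integral>\<theta>'. exp (l \<theta>' - l \<theta>) * p \<theta>' \<partial>\<mu>) * sqrt (real N) ^ d \<le> laplace_upper D \<rho> c \<gamma>"
proof -
  let ?x = "\<psi> \<theta>" and ?n = "real N"
  let ?q = "2 * \<rho> / (real D + 1)"
  let ?h = "\<lambda>\<theta>'. exp (l \<theta>' - l \<theta>) * p \<theta>'"
  let ?I = "\<integral>\<theta>'. ?h \<theta>' \<partial>\<mu>"
  have n: "1 \<le> ?n" using N by simp
  have sn: "1 \<le> sqrt ?n" "0 < sqrt ?n" "(sqrt ?n)\<^sup>2 = ?n" using n by auto
  have q: "0 < ?q" using pos by simp
  have g0: "0 < g0" using pos by linarith
  have p_meas: "p \<in> borel_measurable \<mu>" and p_nonneg: "\<And>\<theta>'. \<theta>' \<in> \<Theta> \<Longrightarrow> 0 \<le> p \<theta>'"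
    and p_int: "(\<integral>\<theta>'. p \<theta>' \<partial>\<mu>) = 1"
    using p by (auto simp: proper_density_def space_vol)
  have p_integrable: "integrable \<mu> p"
    using p_int not_integrable_integral_eq by fastforce
  have p_nn: "(\<integral>\<^sup>+\<theta>'. ennreal (p \<theta>') \<partial>\<mu>) = 1"
    using nn_integral_eq_integral[OF p_integrable AE_I2] p_nonneg p_int by (simp add: space_vol)
  have h_meas: "?h \<in> borel_measurable \<mu>"
    by (intro borel_measurable_times p_meas measurable_compose[OF _ borel_measurable_exp]
        borel_measurable_diff l borel_measurable_const)
  have h_nonneg: "0 \<le> ?h \<theta>'" if "\<theta>' \<in> \<Theta>" for \<theta>' using p_nonneg[OF that] by simp
  have h_integrable: "integrable \<mu> ?h"
  proof (rule Bochner_Integration.integrable_bound[OF p_integrable h_meas])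
    show "AE \<theta>' in \<mu>. norm (?h \<theta>') \<le> norm (p \<theta>')"
    proof (rule AE_I2)
      fix \<theta>' assume "\<theta>' \<in> space \<mu>"
      then have "\<theta>' \<in> \<Theta>" by (simp add: space_vol)
      then show "norm (?h \<theta>') \<le> norm (p \<theta>')"
        using max[of \<theta>'] p_nonneg[of \<theta>'] by (simp add: abs_mult mult_left_le_one_le)
    qed
  qed
  have I: "(\<integral>\<^sup>+\<theta>'. ennreal (?h \<theta>') \<partial>\<mu>) = ennreal ?I"
    by (rule nn_integral_eq_integral[OF h_integrable AE_I2]) (simp add: space_vol h_nonneg)
  have I_nonneg: "0 \<le> ?I"
    by (rule integral_nonneg_AE[OF AE_I2]) (simp add: space_vol h_nonneg)

  have cube: "edist d u ?x \<le> \<rho> / r" "u \<in> \<psi> ` V"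
    if "u \<in> cube d ?x (\<rho> / ((real D + 1) * r))" "1 \<le> r" for u r
  proof -
    have "edist d u ?x \<le> real d * (\<rho> / ((real D + 1) * r))" by (rule edist_cube_le[OF that(1)])
    also have "\<dots> = (real d / (real D + 1)) * (\<rho> / r)" by simp
    also have "\<dots> \<le> 1 * (\<rho> / r)" using D pos that(2) by (intro mult_right_mono) auto
    finally show 1: "edist d u ?x \<le> \<rho> / r" by simp
    also have "\<rho> / r \<le> \<rho>" using pos that(2) by (simp add: field_simps)
    finally show "u \<in> \<psi> ` V" using that(1) by (intro ball) (auto simp: cube_def PiE_iff)
  qed
  have r1: "\<rho> / r \<le> \<rho>" if "1 \<le> r" for r using pos that by (simp add: field_simps)

  \<comment> \<open>The mass that the prior puts on the cube of half-side \<open>\<rho> / (D + 1)\<close> is at most one.\<close>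
  have "ennreal (g0 / 2 * (2 * (\<rho> / ((real D + 1) * 1))) ^ d) \<le> (\<integral>\<^sup>+\<theta>'. ennreal (p \<theta>') \<partial>\<mu>)"
  proof (rule nn_integral_ge_cube)
    fix \<theta>' assume "\<theta>' \<in> V" "\<psi> \<theta>' \<in> cube d ?x (\<rho> / ((real D + 1) * 1))"
    then show "g0 / 2 \<le> p \<theta>' * w (\<psi> \<theta>')" using g[of \<theta>'] cube(1)[of "\<psi> \<theta>'" 1] by simp
  qed (use pos g0 cube[of _ 1] in auto)
  then have "g0 / 2 * ?q ^ d \<le> 1"
    by (simp add: p_nn ennreal_le_1)
  moreover have "g0 / 2 * min 1 ?q ^ D \<le> g0 / 2 * ?q ^ d"
    using min_one_power_le[OF q D] g0 by (intro mult_left_mono) auto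
  ultimately have "g0 * min 1 ?q ^ D \<le> 2" by simp
  then have g0_le: "g0 \<le> 2 / min 1 ?q ^ D" using q by (simp add: pos_le_divide_eq)

  \<comment> \<open>Lower bound: on this cube the distance to the maximizer is at most \<open>\<rho> / \<surd>n\<close>.\<close>
  let ?s = "\<rho> / ((real D + 1) * sqrt ?n)"
  let ?m = "exp (- B * \<rho>\<^sup>2) * (g0 / 2)"
  have "ennreal (?m * (2 * ?s) ^ d) \<le> (\<integral>\<^sup>+\<theta>'. ennreal (?h \<theta>') \<partial>\<mu>)"
  proof (rule nn_integral_ge_cube)
    fix \<theta>' assume \<theta>': "\<theta>' \<in> V" "\<psi> \<theta>' \<in> cube d ?x ?s"
    let ?e = "edist d (\<psi> \<theta>') ?x"
    have e: "?e \<le> \<rho> / sqrt ?n" using cube(1)[OF \<theta>'(2) sn(1)] .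
    then have e\<rho>: "?e \<le> \<rho>" using r1[OF sn(1)] by linarith
    have "?e\<^sup>2 \<le> (\<rho> / sqrt ?n)\<^sup>2" using e by (intro power_mono edist_nonneg)
    then have "?n * ?e\<^sup>2 \<le> \<rho>\<^sup>2" using n by (simp add: power_divide field_simps)
    then have "B * ?n * ?e\<^sup>2 \<le> B * \<rho>\<^sup>2" using pos by simp
    then have "- B * \<rho>\<^sup>2 \<le> l \<theta>' - l \<theta>" using lo[OF \<theta>'(1) e\<rho>] by simp
    then have "?m \<le> exp (l \<theta>' - l \<theta>) * (p \<theta>' * w (\<psi> \<theta>'))"
      using g[OF \<theta>'(1) e\<rho>] g0 by (intro mult_mono) auto
    then show "?m \<le> ?h \<theta>' * w (\<psi> \<theta>')" by (simp add: mult.assoc)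
  next
    show "cube d ?x ?s \<subseteq> \<psi> ` V" using cube(2)[OF _ sn(1)] by blast
  qed (use pos g0 n in auto)
  then have "?m * (2 * ?s) ^ d \<le> ?I" using I I_nonneg by simp
  then have "?m * (2 * ?s) ^ d * sqrt ?n ^ d \<le> ?I * sqrt ?n ^ d"
    using sn by (intro mult_right_mono) auto
  moreover have "(2 * ?s) ^ d * sqrt ?n ^ d = ?q ^ d"
    using sn(2) by (simp add: power_mult_distrib[symmetric])
  ultimately have "?m * ?q ^ d \<le> ?I * sqrt ?n ^ d" by (simp only: mult.assoc)
  moreover have "exp (- B * \<rho>\<^sup>2) * (a / 2) * min 1 ?q ^ D \<le> ?m * ?q ^ d"
    using pos min_one_power_le[OF q D] q by (intro mult_mono) auto
  ultimately show "laplace_lower D \<rho> B a \<le> ?I * sqrt ?n ^ d" unfolding laplace_lower_def by linarith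

  \<comment> \<open>Upper bound: Gaussian near the maximizer, exponentially small far from it.\<close>
  have cn: "0 < c * ?n" using pos n by simp
  have "(\<integral>\<^sup>+\<theta>'. ennreal (?h \<theta>') \<partial>\<mu>) \<le> ennreal (exp (- \<gamma> * ?n) + 3 / 2 * g0 * sqrt (pi / (c * ?n)) ^ d)"
  proof (rule nn_integral_le_gaussian[OF cn _ _ p_meas p_nonneg p_nn, where x = ?x])
    fix \<theta>' assume \<theta>': "\<theta>' \<in> \<Theta>"
    show "?h \<theta>' \<le> exp (- \<gamma> * ?n) * p \<theta>' \<or> \<theta>' \<in> V \<and>
        ?h \<theta>' * w (\<psi> \<theta>') \<le> 3 / 2 * g0 * exp (- (c * ?n) * (edist d (\<psi> \<theta>') ?x)\<^sup>2)"
    proof (cases "\<theta>' \<in> V \<and> edist d (\<psi> \<theta>') ?x < \<rho>")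
      case True
      then have V: "\<theta>' \<in> V" and e: "edist d (\<psi> \<theta>') ?x \<le> \<rho>" by auto
      have "exp (l \<theta>' - l \<theta>) * (p \<theta>' * w (\<psi> \<theta>'))
          \<le> exp (- (c * ?n) * (edist d (\<psi> \<theta>') ?x)\<^sup>2) * (3 / 2 * g0)"
        using hi[OF V e] g[OF V e] g0 by (intro mult_mono[of _ _ "p \<theta>' * w (\<psi> \<theta>')"]) auto
      then show ?thesis using V by (simp add: ac_simps)
    next
      case False
      then have "\<theta>' \<in> far d \<Theta> V \<psi> \<theta> \<rho>" using \<theta>' by (simp add: far_def)
      then have "exp (l \<theta>' - l \<theta>) \<le> exp (- \<gamma> * ?n)" using far[of \<theta>'] by simp
      then have "?h \<theta>' \<le> exp (- \<gamma> * ?n) * p \<theta>'" using p_nonneg[OF \<theta>'] by (rule mult_right_mono)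
      then show ?thesis ..
    qed
  qed (use g0 in auto)
  then have "?I \<le> exp (- \<gamma> * ?n) + 3 / 2 * g0 * sqrt (pi / (c * ?n)) ^ d"
    unfolding I using g0 cn by (subst (asm) ennreal_le_iff) auto
  then have "?I * sqrt ?n ^ d \<le> (exp (- \<gamma> * ?n) + 3 / 2 * g0 * sqrt (pi / (c * ?n)) ^ d) * sqrt ?n ^ d"
    using sn by (intro mult_right_mono) auto
  also have "\<dots> = exp (- \<gamma> * ?n) * sqrt ?n ^ d + 3 / 2 * g0 * sqrt (pi / c) ^ d"
    using sn(2) by (simp add: distrib_right real_sqrt_mult real_sqrt_divide power_divide power_mult_distrib)
  also have "\<dots> \<le> (real (Suc D) / \<gamma>) ^ D + 3 / min 1 ?q ^ D * max 1 (sqrt (pi / c)) ^ D"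
  proof (rule add_mono)
    have "sqrt ?n \<le> ?n" using n by (simp add: real_le_lsqrt power2_eq_square real_sqrt_le_iff)
    then have "sqrt ?n ^ d \<le> ?n ^ d" using sn by (intro power_mono) auto
    also have "\<dots> \<le> ?n ^ D" using n D by (intro power_increasing) auto
    also have "\<dots> \<le> (real (Suc D) / \<gamma>) ^ D * exp (\<gamma> * ?n)"
      by (rule power_le_exp) (use pos n in auto)
    finally show "exp (- \<gamma> * ?n) * sqrt ?n ^ d \<le> (real (Suc D) / \<gamma>) ^ D"
      by (simp add: exp_minus field_simps)
    show "3 / 2 * g0 * sqrt (pi / c) ^ d \<le> 3 / min 1 ?q ^ D * max 1 (sqrt (pi / c)) ^ D"
    proof (rule mult_mono)
      show "3 / 2 * g0 \<le> 3 / min 1 ?q ^ D" using g0_le by simp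
      show "sqrt (pi / c) ^ d \<le> max 1 (sqrt (pi / c)) ^ D" using pos D by (intro le_max_one_power) auto
    qed (use q pos in auto)
  qed
  finally show "?I * sqrt ?n ^ d \<le> laplace_upper D \<rho> c \<gamma>" unfolding laplace_upper_def .
qed

end


section \<open>A uniform Laplace expansion of log-marginals\<close>

lemma measured_chart_of_atlas:
  assumes "smooth_manifold d \<Theta> \<A>" "smooth_measure d \<Theta> \<A> \<mu>" "(V, \<psi>) \<in> \<A>" "coord_density d \<mu> V \<psi> w"
  shows "measured_chart d \<Theta> \<mu> V \<psi> w"
proof
  have "openin (top_of_set \<Theta>) V \<and> openin (powertop_real {..<d}) (\<psi> ` V) \<and>
      homeomorphic_map (top_of_set V) (subtopology (powertop_real {..<d}) (\<psi> ` V)) \<psi>"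
    using assms(1,3) unfolding smooth_manifold_def by blast
  then show "openin (top_of_set \<Theta>) V" "openin (powertop_real {..<d}) (\<psi> ` V)"
    "homeomorphic_map (top_of_set V) (subtopology (powertop_real {..<d}) (\<psi> ` V)) \<psi>" by auto
qed (use assms in \<open>auto simp: smooth_measure_def\<close>)

text \<open>Chart domains are open in the manifold, so continuity within a chart domain is continuity within the
  manifold.\<close>

lemma continuous_on_manifold:
  fixes l :: "'p::{second_countable_topology, t2_space} \<Rightarrow> real"
  assumes man: "smooth_manifold d \<Theta> \<A>" and meas: "smooth_measure d \<Theta> \<A> \<mu>"
    and l: "\<And>V \<psi>. (V, \<psi>) \<in> \<A> \<Longrightarrow> C_on d k (\<psi> ` V) (\<lambda>u. l (inv_into V \<psi> u))"
  shows "continuous_on \<Theta> l"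
  unfolding continuous_on_def
proof
  fix \<theta> assume "\<theta> \<in> \<Theta>"
  then obtain V \<psi> where V: "(V, \<psi>) \<in> \<A>" "\<theta> \<in> V"
    using man unfolding smooth_manifold_def by blast
  then obtain w where "coord_density d \<mu> V \<psi> w" using meas unfolding smooth_measure_def by blast
  then interpret measured_chart d \<Theta> \<mu> V \<psi> w by (rule measured_chart_of_atlas[OF man meas V(1)])
  have "continuous_on V (\<lambda>\<theta>. l (inv_into V \<psi> (\<psi> \<theta>)))"
    by (rule continuous_on_compose2[OF continuous_on_of_C_on[OF image_open l[OF V(1)]] continuous_on_chart]) simp
  then have "continuous_on V l"
    by (rule continuous_on_eq) (simp add: inv_into_f_f[OF inj_chart])
  then have "(l \<longlongrightarrow> l \<theta>) (at \<theta> within V)" using V(2) by (simp add: continuous_on_def)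
  moreover obtain G where "open G" "V = \<Theta> \<inter> G" using V_open unfolding openin_open by blast
  then have "at \<theta> within V = at \<theta> within \<Theta>"
    using V(2) by (intro at_within_nhd[of \<theta> G]) auto
  ultimately show "(l \<longlongrightarrow> l \<theta>) (at \<theta> within \<Theta>)" by simp
qed

lemma borel_measurable_loglik:
  assumes "regular_model M y"
  shows "loglik M y \<in> borel_measurable (pm_vol M)"
proof -
  have man: "smooth_manifold (pm_dim M) (pm_space M) (pm_atlas M)"
    and meas: "smooth_measure (pm_dim M) (pm_space M) (pm_atlas M) (pm_vol M)"
    and C: "\<And>V \<psi>. (V, \<psi>) \<in> pm_atlas M \<Longrightarrow> C_on (pm_dim M) 3 (\<psi> ` V) (\<lambda>u. loglik M y (inv_into V \<psi> u))"
    using assms unfolding regular_model_def by blast+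
  have "loglik M y \<in> borel_measurable (restrict_space borel (pm_space M))"
    by (rule borel_measurable_continuous_on_restrict[OF continuous_on_manifold[OF man meas C]])
  moreover have "sets (pm_vol M) = sets (restrict_space borel (pm_space M))"
    using meas by (simp add: smooth_measure_def)
  ultimately show ?thesis by (simp cong: measurable_cong_sets)
qed

text \<open>Factoring out the likelihood at \<open>\<theta>\<close>, later the maximizer, leaves an integrand that is dominated by the
  prior density; this is the integral bounded by \<open>laplace_integral_bounds\<close>.\<close>

lemma marginal_eq_normalized:
  assumes "regular_model M y"
  shows "marginal M y = exp (loglik M y \<theta>) * (\<integral>\<theta>'. exp (loglik M y \<theta>' - loglik M y \<theta>) * pm_prior M \<theta>' \<partial>pm_vol M)"
proof -
  have "sets (pm_vol M) = sets (restrict_space borel (pm_space M))"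
    using assms by (simp add: regular_model_def smooth_measure_def)
  then have space: "space (pm_vol M) = pm_space M"
    by (auto dest: sets_eq_imp_space_eq simp: space_restrict_space)
  have pos: "0 < pm_lik M y \<theta>'" if "\<theta>' \<in> pm_space M" for \<theta>'
    using assms that by (simp add: regular_model_def)
  have "marginal M y = (\<integral>\<theta>'. exp (loglik M y \<theta>) * (exp (loglik M y \<theta>' - loglik M y \<theta>) * pm_prior M \<theta>') \<partial>pm_vol M)"
    unfolding marginal_def set_lebesgue_integral_def
    by (intro Bochner_Integration.integral_cong)
      (auto simp: space pos loglik_def exp_diff)
  then show ?thesis by simp
qed

lemma max_loglik_eq:
  assumes "cond_L1 (pm_space M) (loglik M y) \<theta>"
  shows "max_loglik M y = loglik M y \<theta>"
  unfolding max_loglik_def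
proof (rule cSup_eq_maximum)
  show "loglik M y \<theta> \<in> loglik M y ` pm_space M" using assms by (auto simp: cond_L1_def)
  fix v assume "v \<in> loglik M y ` pm_space M"
  then show "v \<le> loglik M y \<theta>" using assms unfolding cond_L1_def by (metis imageE less_imp_le order_refl)
qed

lemma abs_ln_between:
  fixes v :: real
  assumes "0 < lo" "lo \<le> v" "v \<le> hi"
  shows "\<bar>ln v\<bar> \<le> \<bar>ln lo\<bar> + \<bar>ln hi\<bar>"
proof -
  have "ln lo \<le> ln v" "ln v \<le> ln hi" using assms by auto
  then show ?thesis by linarith
qed

text \<open>On a ball of radius \<open>\<rho> \<le> c / M\<close> the cubic Taylor remainder is at most a third of the quadratic term.\<close>

lemma quadratic_decay_from_taylor:
  fixes c C \<rho> e N M :: real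
  assumes "0 \<le> e" "e \<le> \<rho>" "M * \<rho> \<le> c" "c \<le> C" "0 \<le> M" "0 \<le> N"
  shows "- (c * N) / 2 * e\<^sup>2 + M * N / 6 * e ^ 3 \<le> - (c / 4) * N * e\<^sup>2"
    and "- C * N * e\<^sup>2 \<le> - (C * N) / 2 * e\<^sup>2 - M * N / 6 * e ^ 3"
proof -
  have "M * e \<le> M * \<rho>" using assms by (intro mult_left_mono) auto
  then have "M * e \<le> c" using assms by linarith
  then have "M * e * (N * e\<^sup>2) \<le> c * (N * e\<^sup>2)" using assms by (intro mult_right_mono) auto
  then have 1: "M * N * e ^ 3 \<le> c * N * e\<^sup>2" by (simp add: power2_eq_square power3_eq_cube ac_simps)
  have "0 \<le> M * e" using assms by (intro mult_nonneg_nonneg)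
  then have "0 \<le> c" using \<open>M * e \<le> c\<close> by linarith
  then have c: "0 \<le> c * (N * e\<^sup>2)" using assms by (intro mult_nonneg_nonneg) auto
  have C: "c * (N * e\<^sup>2) \<le> C * (N * e\<^sup>2)" using assms by (intro mult_right_mono) auto
  show "- (c * N) / 2 * e\<^sup>2 + M * N / 6 * e ^ 3 \<le> - (c / 4) * N * e\<^sup>2"
    using 1 c by (simp add: ac_simps)
  show "- C * N * e\<^sup>2 \<le> - (C * N) / 2 * e\<^sup>2 - M * N / 6 * e ^ 3"
    using 1 c C by (simp add: ac_simps)
qed

text \<open>Only the logarithm up to a bounded error is needed, so two-sided bounds up to constant factors replace the
  exact asymptotic constant of Laplace's method. What matters is that these constants are the same for all
  members of the family, which holds because they are built from the constants that the family shares.\<close>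

lemma laplace_applies_imp_log_marginal_bound:
  assumes "laplace_applies I M y N"
  obtains A N0 where "\<And>i. i \<in> I \<Longrightarrow> N0 \<le> N i \<Longrightarrow>
    0 < marginal (M i) (y i) \<and> \<bar>ln (marginal (M i) (y i)) - laplace_score (M i) (y i) (N i)\<bar> \<le> A"
proof -
  let ?d = "\<lambda>i. pm_dim (M i)" and ?l = "\<lambda>i. loglik (M i) (y i)"
  have reg: "\<And>i. i \<in> I \<Longrightarrow> regular_model (M i) (y i)"
    using assms unfolding laplace_applies_def by blast
  obtain D where D: "\<And>i. i \<in> I \<Longrightarrow> ?d i \<le> D"
    using assms unfolding laplace_applies_def by blast
  have "\<exists>\<theta> V \<psi> w.
        (\<forall>i\<in>I. (V i, \<psi> i) \<in> pm_atlas (M i) \<and> \<theta> i \<in> V i \<and> coord_density (?d i) (pm_vol (M i)) (V i) (\<psi> i) (w i)) \<and>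
        prior_cond I ?d (\<lambda>i. \<psi> i ` V i) (\<lambda>i u. pm_prior (M i) (inv_into (V i) (\<psi> i) u) * w i u) (\<lambda>i. \<psi> i (\<theta> i)) \<and>
        (\<forall>i\<in>I. cond_L1 (pm_space (M i)) (?l i) (\<theta> i)) \<and>
        cond_L2 I N ?d (\<lambda>i u. ?l i (inv_into (V i) (\<psi> i) u)) (\<lambda>i. \<psi> i (\<theta> i)) \<and>
        cond_L3 I N ?d (\<lambda>i. \<psi> i ` V i) (\<lambda>i u. ?l i (inv_into (V i) (\<psi> i) u)) (\<lambda>i. \<psi> i (\<theta> i)) \<and>
        cond_L4 I N ?l \<theta> (\<lambda>i. far (?d i) (pm_space (M i)) (V i) (\<psi> i) (\<theta> i))"
    using assms unfolding laplace_applies_def Let_def by (elim conjE)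
  then obtain \<theta> V \<psi> w where
    chart: "\<forall>i\<in>I. (V i, \<psi> i) \<in> pm_atlas (M i) \<and> \<theta> i \<in> V i \<and> coord_density (?d i) (pm_vol (M i)) (V i) (\<psi> i) (w i)"
    and prior: "prior_cond I ?d (\<lambda>i. \<psi> i ` V i) (\<lambda>i u. pm_prior (M i) (inv_into (V i) (\<psi> i) u) * w i u) (\<lambda>i. \<psi> i (\<theta> i))"
    and L1: "\<forall>i\<in>I. cond_L1 (pm_space (M i)) (?l i) (\<theta> i)"
    and L2: "cond_L2 I N ?d (\<lambda>i u. ?l i (inv_into (V i) (\<psi> i) u)) (\<lambda>i. \<psi> i (\<theta> i))"
    and L3: "cond_L3 I N ?d (\<lambda>i. \<psi> i ` V i) (\<lambda>i u. ?l i (inv_into (V i) (\<psi> i) u)) (\<lambda>i. \<psi> i (\<theta> i))"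
    and L4: "cond_L4 I N ?l \<theta> (\<lambda>i. far (?d i) (pm_space (M i)) (V i) (\<psi> i) (\<theta> i))"
    by (elim exE conjE) (rule that; assumption)
  let ?x = "\<lambda>i. \<psi> i (\<theta> i)"
  let ?f = "\<lambda>i u. ?l i (inv_into (V i) (\<psi> i) u)"
  let ?g = "\<lambda>i u. pm_prior (M i) (inv_into (V i) (\<psi> i) u) * w i u"

  obtain a where a: "0 < a" "\<And>i. i \<in> I \<Longrightarrow> a \<le> ?g i (?x i)"
    using prior unfolding prior_cond_def by blast
  have "\<forall>\<epsilon>>0. \<exists>\<delta>>0. \<forall>i\<in>I. \<forall>u\<in>\<psi> i ` V i. edist (?d i) u (?x i) < \<delta> \<longrightarrow> \<bar>?g i u - ?g i (?x i)\<bar> < \<epsilon>"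
    using prior unfolding prior_cond_def by (elim conjE)
  from this[rule_format, of "a / 2"] a(1) obtain \<delta> where \<delta>: "0 < \<delta>"
    "\<And>i u. i \<in> I \<Longrightarrow> u \<in> \<psi> i ` V i \<Longrightarrow> edist (?d i) u (?x i) < \<delta> \<Longrightarrow> \<bar>?g i u - ?g i (?x i)\<bar> < a / 2"
    by auto
  obtain c C N2 where cC: "0 < c" "c < C" and eig: "\<And>i e. i \<in> I \<Longrightarrow> N2 \<le> N i \<Longrightarrow>
      eigenvalue (neg_hessian (?d i) (?f i) (?x i)) e \<Longrightarrow> c * real (N i) \<le> e \<and> e \<le> C * real (N i)"
    using L2 unfolding cond_L2_def by blast
  obtain \<rho>3 M3 N3 where \<rho>3: "0 < \<rho>3" and third: "\<And>i u. i \<in> I \<Longrightarrow> N3 \<le> N i \<Longrightarrow>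
      u \<in> topspace (powertop_real {..<?d i}) \<Longrightarrow> edist (?d i) u (?x i) \<le> \<rho>3 \<Longrightarrow>
      u \<in> \<psi> i ` V i \<and> norm_deriv3 (?d i) (?f i) u \<le> M3 * real (N i)"
    using L3 unfolding cond_L3_def by blast
  define K where "K = max M3 1"
  \<comment> \<open>Inside radius \<open>\<rho>\<close> the third derivative bound holds, the prior density varies by less
      than \<open>a / 2\<close>, and the cubic remainder is dominated by the quadratic term.\<close>
  define \<rho> where "\<rho> = min \<rho>3 (min (\<delta> / 2) (c / K))"
  have K: "0 < K" "M3 \<le> K" by (auto simp: K_def)
  have \<rho>: "0 < \<rho>" "\<rho> \<le> \<rho>3" "\<rho> < \<delta>" and "\<rho> \<le> c / K" using \<rho>3 \<delta>(1) cC K by (auto simp: \<rho>_def)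
  then have K\<rho>: "K * \<rho> \<le> c" using K by (simp add: field_simps)
  have "\<exists>\<gamma>>0. \<exists>N4. \<forall>i\<in>I. N4 \<le> N i \<longrightarrow>
      (\<forall>\<theta>'\<in>far (?d i) (pm_space (M i)) (V i) (\<psi> i) (\<theta> i) \<rho>. ?l i \<theta>' \<le> ?l i (\<theta> i) - \<gamma> * real (N i))"
    using L4 \<rho>(1) unfolding cond_L4_def by simp
  then obtain \<gamma> N4 where \<gamma>: "0 < \<gamma>" and far: "\<And>i \<theta>'. i \<in> I \<Longrightarrow> N4 \<le> N i \<Longrightarrow>
      \<theta>' \<in> far (?d i) (pm_space (M i)) (V i) (\<psi> i) (\<theta> i) \<rho> \<Longrightarrow> ?l i \<theta>' \<le> ?l i (\<theta> i) - \<gamma> * real (N i)"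
    by blast
  let ?lo = "laplace_lower D \<rho> C a" and ?hi = "laplace_upper D \<rho> (c / 4) \<gamma>"
  have lo_pos: "0 < ?lo" using a(1) \<rho>(1) by (simp add: laplace_lower_def)

  show thesis
  proof (rule that)
    fix i assume i: "i \<in> I" and N0: "max (max 1 N2) (max N3 N4) \<le> N i"
    then have N: "1 \<le> N i" "N2 \<le> N i" "N3 \<le> N i" "N4 \<le> N i" by auto
    let ?n = "real (N i)" and ?U = "\<psi> i ` V i"
    have man: "smooth_manifold (?d i) (pm_space (M i)) (pm_atlas (M i))"
      and meas: "smooth_measure (?d i) (pm_space (M i)) (pm_atlas (M i)) (pm_vol (M i))"
      and p: "proper_density (pm_vol (M i)) (pm_prior (M i))"
      using reg[OF i] by (auto simp: regular_model_def)
    have V: "(V i, \<psi> i) \<in> pm_atlas (M i)" and \<theta>V: "\<theta> i \<in> V i"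
      and dens: "coord_density (?d i) (pm_vol (M i)) (V i) (\<psi> i) (w i)" using chart i by auto
    have f: "C_on (?d i) 3 ?U (?f i)"
      using reg[OF i] V by (auto simp: regular_model_def)
    interpret measured_chart "?d i" "pm_space (M i)" "pm_vol (M i)" "V i" "\<psi> i" "w i"
      by (rule measured_chart_of_atlas[OF man meas V dens])
    have inv: "inv_into (V i) (\<psi> i) (\<psi> i \<theta>') = \<theta>'" if "\<theta>' \<in> V i" for \<theta>'
      using that by (rule inv_into_f_f[OF inj_chart])
    have max: "?l i \<theta>' \<le> ?l i (\<theta> i)" if "\<theta>' \<in> pm_space (M i)" for \<theta>'
      using L1 i that unfolding cond_L1_def by (metis less_imp_le order_refl)
    have fmax: "?f i u \<le> ?f i (?x i)" if "u \<in> ?U" for u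
    proof -
      from that obtain \<theta>' where \<theta>': "\<theta>' \<in> V i" "u = \<psi> i \<theta>'" by blast
      then have "\<theta>' \<in> pm_space (M i)" using chart_subset by blast
      then show ?thesis using max \<theta>' by (simp add: inv \<theta>V)
    qed
    have ball: "u \<in> ?U \<and> norm_deriv3 (?d i) (?f i) u \<le> K * ?n"
      if "u \<in> PiE {..<?d i} (\<lambda>_. UNIV)" "edist (?d i) u (?x i) \<le> \<rho>" for u
    proof -
      have "u \<in> ?U \<and> norm_deriv3 (?d i) (?f i) u \<le> M3 * ?n"
        by (rule third[OF i N(3)]) (use that \<rho>(2) in auto)
      moreover have "M3 * ?n \<le> K * ?n" using K by (intro mult_right_mono) auto
      ultimately show ?thesis by linarith
    qed
    have quad: "?l i (\<theta> i) - C * ?n * (edist (?d i) (\<psi> i \<theta>') (?x i))\<^sup>2 \<le> ?l i \<theta>' \<and>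
        ?l i \<theta>' \<le> ?l i (\<theta> i) - c / 4 * ?n * (edist (?d i) (\<psi> i \<theta>') (?x i))\<^sup>2"
      if \<theta>': "\<theta>' \<in> V i" and e: "edist (?d i) (\<psi> i \<theta>') (?x i) \<le> \<rho>" for \<theta>'
    proof -
      have u: "\<psi> i \<theta>' \<in> PiE {..<?d i} (\<lambda>_. UNIV)" using image_subset \<theta>' by blast
      have xU: "?x i \<in> ?U" using \<theta>V by blast
      note T = taylor_at_maximizer[OF image_open f xU fmax eig[OF i N(2)] ball u e]
      note Q = quadratic_decay_from_taylor[OF edist_nonneg e K\<rho> less_imp_le[OF cC(2)] less_imp_le[OF K(1)], of ?n]
      show ?thesis using T Q by (simp add: inv \<theta>' \<theta>V)
    qed
    have g: "?g i (?x i) / 2 \<le> pm_prior (M i) \<theta>' * w i (\<psi> i \<theta>') \<and>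
        pm_prior (M i) \<theta>' * w i (\<psi> i \<theta>') \<le> 3 / 2 * ?g i (?x i)"
      if \<theta>': "\<theta>' \<in> V i" and e: "edist (?d i) (\<psi> i \<theta>') (?x i) \<le> \<rho>" for \<theta>'
    proof -
      have "\<bar>?g i (\<psi> i \<theta>') - ?g i (?x i)\<bar> < a / 2"
        by (rule \<delta>(2)[OF i]) (use \<theta>' e \<rho>(3) in auto)
      moreover have "?g i (\<psi> i \<theta>') = pm_prior (M i) \<theta>' * w i (\<psi> i \<theta>')" by (simp add: inv \<theta>')
      ultimately show ?thesis using a(2)[OF i] by linarith
    qed
    let ?I = "\<integral>\<theta>'. exp (?l i \<theta>' - ?l i (\<theta> i)) * pm_prior (M i) \<theta>' \<partial>pm_vol (M i)"
    have C0: "0 < C" and c4: "0 < c / 4" using cC by auto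
    note bounds = laplace_integral_bounds[OF borel_measurable_loglik[OF reg[OF i]] p \<theta>V max D[OF i] N(1)
        \<rho>(1) c4 C0 \<gamma> a(1) a(2)[OF i] conjunct1[OF ball] conjunct1[OF quad] conjunct2[OF quad] g far[OF i N(4)]]
    have sn: "0 < sqrt ?n" using N(1) by simp
    have Ipos: "0 < ?I"
      using less_le_trans[OF lo_pos bounds(1)] sn by (simp add: zero_less_mult_iff)
    have marg: "marginal (M i) (y i) = exp (?l i (\<theta> i)) * ?I"
      by (rule marginal_eq_normalized[OF reg[OF i]])
    have "ln (?I * sqrt ?n ^ ?d i) = ln ?I + real (?d i) / 2 * ln ?n"
      using Ipos sn by (simp add: ln_mult ln_realpow ln_sqrt)
    moreover have "ln (marginal (M i) (y i)) = ?l i (\<theta> i) + ln ?I"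
      unfolding marg using Ipos by (simp add: ln_mult)
    moreover have "laplace_score (M i) (y i) (N i) = ?l i (\<theta> i) - real (?d i) / 2 * ln ?n"
      using max_loglik_eq[OF L1[rule_format, OF i]] by (simp add: laplace_score_def)
    ultimately have "ln (marginal (M i) (y i)) - laplace_score (M i) (y i) (N i) = ln (?I * sqrt ?n ^ ?d i)"
      by simp
    then show "0 < marginal (M i) (y i) \<and>
        \<bar>ln (marginal (M i) (y i)) - laplace_score (M i) (y i) (N i)\<bar> \<le> \<bar>ln ?lo\<bar> + \<bar>ln ?hi\<bar>"
      using abs_ln_between[OF lo_pos bounds] Ipos by (simp add: marg)
  qed
qed


section \<open>Log-likelihood of a collapsed block model\<close>

text \<open>A mixture lies between its dominant term and its total weight times the largest component, so replacing
  its logarithm by a maximum costs only a constant that depends on the weights.\<close>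

lemma log_mixture_bound:
  fixes m s :: "'t \<Rightarrow> real"
  assumes T: "finite T" "T \<noteq> {}" and \<pi>: "\<And>t. t \<in> T \<Longrightarrow> 0 < \<pi> t"
    and m: "\<And>t. t \<in> T \<Longrightarrow> 0 < m t \<and> \<bar>ln (m t) - s t\<bar> \<le> A"
  shows "0 < (\<Sum>t\<in>T. \<pi> t * m t)"
    and "\<bar>ln (\<Sum>t\<in>T. \<pi> t * m t) - Max (s ` T)\<bar> \<le> A + \<bar>ln (sum \<pi> T)\<bar> + \<bar>ln (Min (\<pi> ` T))\<bar>"
proof -
  show pos: "0 < (\<Sum>t\<in>T. \<pi> t * m t)" using T \<pi> m by (intro sum_pos) auto
  have \<pi>_pos: "0 < sum \<pi> T" using T \<pi> by (intro sum_pos) auto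
  have min_pos: "0 < Min (\<pi> ` T)" using T \<pi> by simp
  have "(\<Sum>t\<in>T. \<pi> t * m t) \<le> (\<Sum>t\<in>T. \<pi> t * exp (Max (s ` T) + A))"
  proof (rule sum_mono)
    fix t assume t: "t \<in> T"
    have "s t \<le> Max (s ` T)" using T t by simp
    then have "ln (m t) \<le> Max (s ` T) + A" using m[OF t] by linarith
    then have "exp (ln (m t)) \<le> exp (Max (s ` T) + A)" by simp
    then have "m t \<le> exp (Max (s ` T) + A)" using m[OF t] by simp
    then show "\<pi> t * m t \<le> \<pi> t * exp (Max (s ` T) + A)" using \<pi>[OF t] by simp
  qed
  also have "\<dots> = sum \<pi> T * exp (Max (s ` T) + A)" by (simp add: sum_distrib_right)
  finally have "ln (\<Sum>t\<in>T. \<pi> t * m t) \<le> ln (sum \<pi> T * exp (Max (s ` T) + A))"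
    using pos \<pi>_pos by simp
  then have upper: "ln (\<Sum>t\<in>T. \<pi> t * m t) \<le> ln (sum \<pi> T) + Max (s ` T) + A"
    using \<pi>_pos by (simp add: ln_mult)
  have "Max (s ` T) \<in> s ` T" using T by (intro Max_in) auto
  then obtain t where t: "t \<in> T" "Max (s ` T) = s t" by blast
  have "Max (s ` T) - A \<le> ln (m t)" using m[OF t(1)] t(2) by linarith
  then have "exp (Max (s ` T) - A) \<le> m t" using m[OF t(1)] by (simp add: ln_ge_iff)
  then have "Min (\<pi> ` T) * exp (Max (s ` T) - A) \<le> \<pi> t * m t"
    using T t(1) min_pos by (intro mult_mono) auto
  also have "\<dots> \<le> (\<Sum>t\<in>T. \<pi> t * m t)"
    by (rule member_le_sum[OF t(1) _ T(1)]) (use \<pi> m in \<open>simp add: less_imp_le\<close>)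
  finally have "ln (Min (\<pi> ` T) * exp (Max (s ` T) - A)) \<le> ln (\<Sum>t\<in>T. \<pi> t * m t)"
    using pos min_pos by simp
  then have "ln (Min (\<pi> ` T)) + Max (s ` T) - A \<le> ln (\<Sum>t\<in>T. \<pi> t * m t)"
    using min_pos by (simp add: ln_mult)
  then show "\<bar>ln (\<Sum>t\<in>T. \<pi> t * m t) - Max (s ` T)\<bar> \<le> A + \<bar>ln (sum \<pi> T)\<bar> + \<bar>ln (Min (\<pi> ` T))\<bar>"
    using upper by linarith
qed

lemma finite_communities: "finite (communities n z)"
  by (simp add: communities_def)

lemma blocks_subset: "blocks directed n z \<subseteq> communities n z \<times> communities n z"
  by (auto simp: blocks_def)

lemma finite_blocks: "finite (blocks directed n z)"
  by (rule finite_subset[OF blocks_subset]) (simp add: finite_communities)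

lemma off_blocks_subset: "off_blocks directed n z \<subseteq> blocks directed n z"
  by (auto simp: off_blocks_def)

lemma complexity_nonneg: "0 \<le> complexity directed n S"
  by (simp add: complexity_def)

lemma complexity_le:
  "complexity directed n S \<le> real (num_communities n (cm_label S)) * (real (num_communities n (cm_label S)) + 1)"
proof -
  let ?C = "communities n (cm_label S)"
  have "card (blocks directed n (cm_label S)) \<le> card (?C \<times> ?C)"
    by (rule card_mono[OF _ blocks_subset]) (simp add: finite_communities)
  then have "real (card (blocks directed n (cm_label S))) \<le> real (card ?C) * real (card ?C)"
    by (simp add: card_cartesian_product of_nat_mult[symmetric] del: of_nat_mult)
  then show ?thesis by (simp add: complexity_def num_communities_def algebra_simps)
qed

text \<open>By the factorization the logarithm of the collapsed likelihood is a sum with one term per off-diagonal block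
  and one per community, and each term contributes a bounded error.\<close>

lemma log_remainder_bound:
  fixes S :: "('y, 't, 'p, 'q) collapsed_model"
  assumes T: "finite T" "T \<noteq> {}" and \<pi>: "\<And>t. t \<in> T \<Longrightarrow> 0 < \<pi> t"
    and fact: "factorizes directed T \<pi> n Y S"
    and out: "\<And>b. b \<in> off_blocks directed n (cm_label S) \<Longrightarrow>
      0 < marginal (cm_out S b) (block_data directed n (cm_label S) Y b) \<and>
      \<bar>ln (marginal (cm_out S b) (block_data directed n (cm_label S) Y b)) -
        laplace_score (cm_out S b) (block_data directed n (cm_label S) Y b) (cm_out_size S b)\<bar> \<le> A"
    and inn: "\<And>k t. k \<in> communities n (cm_label S) \<Longrightarrow> t \<in> T \<Longrightarrow>
      0 < marginal (cm_in S k t) (community_data directed n (cm_label S) Y k) \<and>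
      \<bar>ln (marginal (cm_in S k t) (community_data directed n (cm_label S) Y k)) - in_score directed n Y S k t\<bar> \<le> B"
    and AB: "A \<le> c" "B + \<bar>ln (sum \<pi> T)\<bar> + \<bar>ln (Min (\<pi> ` T))\<bar> \<le> c" "0 \<le> c"
  shows "0 < cm_prob S Y (cm_label S)"
    and "\<bar>log_remainder directed T n Y S\<bar> \<le> c * complexity directed n S"
proof -
  let ?z = "cm_label S"
  let ?O = "off_blocks directed n ?z" and ?C = "communities n ?z"
  let ?mo = "\<lambda>b. marginal (cm_out S b) (block_data directed n ?z Y b)"
  let ?so = "\<lambda>b. laplace_score (cm_out S b) (block_data directed n ?z Y b) (cm_out_size S b)"
  let ?mi = "\<lambda>k. \<Sum>t\<in>T. \<pi> t * marginal (cm_in S k t) (community_data directed n ?z Y k)"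
  let ?si = "\<lambda>k. Max (in_score directed n Y S k ` T)"
  have finO: "finite ?O" by (rule finite_subset[OF off_blocks_subset finite_blocks])
  have mix: "0 < ?mi k \<and> \<bar>ln (?mi k) - ?si k\<bar> \<le> c" if "k \<in> ?C" for k
  proof -
    note L = log_mixture_bound[OF T, where \<pi> = \<pi> and s = "in_score directed n Y S k" and A = B
        and m = "\<lambda>t. marginal (cm_in S k t) (community_data directed n ?z Y k)"]
    have "0 < ?mi k" by (rule L(1)) (erule \<pi>, rule inn[OF that])
    moreover have "\<bar>ln (?mi k) - ?si k\<bar> \<le> B + \<bar>ln (sum \<pi> T)\<bar> + \<bar>ln (Min (\<pi> ` T))\<bar>"
      by (rule L(2)) (erule \<pi>, rule inn[OF that])
    ultimately show ?thesis using AB(2) by linarith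
  qed
  have mi_pos: "0 < ?mi k" and mi: "\<bar>ln (?mi k) - ?si k\<bar> \<le> c" if "k \<in> ?C" for k
    using mix[OF that] by auto
  have mo_pos: "0 < ?mo b" and mo: "\<bar>ln (?mo b) - ?so b\<bar> \<le> c" if "b \<in> ?O" for b
    using out[OF that] AB(1) by auto
  have prob: "cm_prob S Y ?z = (\<Prod>k\<in>?C. ?mi k) * (\<Prod>b\<in>?O. ?mo b)"
    using fact by (simp add: factorizes_def)
  have P: "0 < (\<Prod>k\<in>?C. ?mi k)" "0 < (\<Prod>b\<in>?O. ?mo b)"
    by (rule prod_pos, erule mi_pos, rule prod_pos, erule mo_pos)
  then show "0 < cm_prob S Y ?z" unfolding prob by (rule mult_pos_pos)
  have "log_prob Y S = ln (\<Prod>k\<in>?C. ?mi k) + ln (\<Prod>b\<in>?O. ?mo b)"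
    unfolding log_prob_def prob using P by (rule ln_mult_pos)
  also have "ln (\<Prod>k\<in>?C. ?mi k) = (\<Sum>k\<in>?C. ln (?mi k))"
    by (rule ln_prod[OF finite_communities less_imp_neq[OF mi_pos, symmetric]])
  also have "ln (\<Prod>b\<in>?O. ?mo b) = (\<Sum>b\<in>?O. ln (?mo b))"
    by (rule ln_prod[OF finO less_imp_neq[OF mo_pos, symmetric]])
  finally have rem: "log_remainder directed T n Y S
      = (\<Sum>k\<in>?C. ln (?mi k) - ?si k) + (\<Sum>b\<in>?O. ln (?mo b) - ?so b)"
    by (simp add: log_remainder_def score_def sum_subtractf)
  have "\<bar>log_remainder directed T n Y S\<bar>
      \<le> (\<Sum>k\<in>?C. \<bar>ln (?mi k) - ?si k\<bar>) + (\<Sum>b\<in>?O. \<bar>ln (?mo b) - ?so b\<bar>)"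
    unfolding rem by (rule order_trans[OF abs_triangle_ineq add_mono[OF sum_abs sum_abs]])
  also have "\<dots> \<le> (\<Sum>k\<in>?C. c) + (\<Sum>b\<in>?O. c)"
    by (rule add_mono[OF sum_mono[OF mi] sum_mono[OF mo]])
  also have "\<dots> = c * (real (card ?O) + real (card ?C))" by (simp add: algebra_simps)
  also have "\<dots> \<le> c * complexity directed n S"
    using AB(3) card_mono[OF finite_blocks off_blocks_subset, of directed n ?z]
    by (intro mult_left_mono) (simp_all add: complexity_def num_communities_def)
  finally show "\<bar>log_remainder directed T n Y S\<bar> \<le> c * complexity directed n S" .
qed

text \<open>The constants of the Laplace bounds are shared by all blocks, communities and types of the whole sequence,
  and once all sample sizes exceed the two thresholds the bounds hold for all of them at once.\<close>

lemma eventually_log_remainder_bound: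
  fixes S :: "nat \<Rightarrow> ('y, 't, 'p::{second_countable_topology, t2_space},
                              'q::{second_countable_topology, t2_space}) collapsed_model"
  assumes T: "finite T" "T \<noteq> {}" and \<pi>: "\<And>t. t \<in> T \<Longrightarrow> 0 < \<pi> t"
    and regime: "laplace_regime directed T \<pi> n Y S" and div: "sizes_diverge directed T n S"
  obtains c where "0 \<le> c"
    "\<forall>\<^sub>F \<nu> in sequentially. 0 < cm_prob (S \<nu>) (Y \<nu>) (cm_label (S \<nu>)) \<and>
       \<bar>log_remainder directed T (n \<nu>) (Y \<nu>) (S \<nu>)\<bar> \<le> c * complexity directed (n \<nu>) (S \<nu>)"
proof -
  have fact: "factorizes directed T \<pi> (n \<nu>) (Y \<nu>) (S \<nu>)" for \<nu>
    using regime unfolding laplace_regime_def by blast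
  obtain A N1 where out: "\<And>i. i \<in> {(\<nu>, b). b \<in> off_blocks directed (n \<nu>) (cm_label (S \<nu>))} \<Longrightarrow>
      N1 \<le> (\<lambda>(\<nu>, b). cm_out_size (S \<nu>) b) i \<Longrightarrow>
      0 < marginal ((\<lambda>(\<nu>, b). cm_out (S \<nu>) b) i) ((\<lambda>(\<nu>, b). block_data directed (n \<nu>) (cm_label (S \<nu>)) (Y \<nu>) b) i) \<and>
      \<bar>ln (marginal ((\<lambda>(\<nu>, b). cm_out (S \<nu>) b) i) ((\<lambda>(\<nu>, b). block_data directed (n \<nu>) (cm_label (S \<nu>)) (Y \<nu>) b) i)) -
        laplace_score ((\<lambda>(\<nu>, b). cm_out (S \<nu>) b) i) ((\<lambda>(\<nu>, b). block_data directed (n \<nu>) (cm_label (S \<nu>)) (Y \<nu>) b) i)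
          ((\<lambda>(\<nu>, b). cm_out_size (S \<nu>) b) i)\<bar> \<le> A"
    using regime unfolding laplace_regime_def by (elim conjE laplace_applies_imp_log_marginal_bound) (rule that)
  obtain B N2 where inn: "\<And>i. i \<in> {(\<nu>, k, t). k \<in> communities (n \<nu>) (cm_label (S \<nu>)) \<and> t \<in> T} \<Longrightarrow>
      N2 \<le> (\<lambda>(\<nu>, k, t). in_size_plus (S \<nu>) k t) i \<Longrightarrow>
      0 < marginal ((\<lambda>(\<nu>, k, t). cm_in (S \<nu>) k t) i) ((\<lambda>(\<nu>, k, t). community_data directed (n \<nu>) (cm_label (S \<nu>)) (Y \<nu>) k) i) \<and>
      \<bar>ln (marginal ((\<lambda>(\<nu>, k, t). cm_in (S \<nu>) k t) i) ((\<lambda>(\<nu>, k, t). community_data directed (n \<nu>) (cm_label (S \<nu>)) (Y \<nu>) k) i)) -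
        laplace_score ((\<lambda>(\<nu>, k, t). cm_in (S \<nu>) k t) i) ((\<lambda>(\<nu>, k, t). community_data directed (n \<nu>) (cm_label (S \<nu>)) (Y \<nu>) k) i)
          ((\<lambda>(\<nu>, k, t). in_size_plus (S \<nu>) k t) i)\<bar> \<le> B"
    using regime unfolding laplace_regime_def by (elim conjE laplace_applies_imp_log_marginal_bound) (rule that)
  define c where "c = max 0 (max A (B + \<bar>ln (sum \<pi> T)\<bar> + \<bar>ln (Min (\<pi> ` T))\<bar>))"
  have c: "A \<le> c" "B + \<bar>ln (sum \<pi> T)\<bar> + \<bar>ln (Min (\<pi> ` T))\<bar> \<le> c" "0 \<le> c"
    by (auto simp: c_def)
  have "\<forall>\<^sub>F \<nu> in sequentially.
      (\<forall>b\<in>off_blocks directed (n \<nu>) (cm_label (S \<nu>)). max N1 N2 \<le> cm_out_size (S \<nu>) b) \<and>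
      (\<forall>k\<in>communities (n \<nu>) (cm_label (S \<nu>)). \<forall>t\<in>T. max N1 N2 \<le> in_size_plus (S \<nu>) k t)"
    using div unfolding sizes_diverge_def by blast
  then have "\<forall>\<^sub>F \<nu> in sequentially. 0 < cm_prob (S \<nu>) (Y \<nu>) (cm_label (S \<nu>)) \<and>
       \<bar>log_remainder directed T (n \<nu>) (Y \<nu>) (S \<nu>)\<bar> \<le> c * complexity directed (n \<nu>) (S \<nu>)"
  proof eventually_elim
    case (elim \<nu>)
    have out': "0 < marginal (cm_out (S \<nu>) b) (block_data directed (n \<nu>) (cm_label (S \<nu>)) (Y \<nu>) b) \<and>
        \<bar>ln (marginal (cm_out (S \<nu>) b) (block_data directed (n \<nu>) (cm_label (S \<nu>)) (Y \<nu>) b)) -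
          laplace_score (cm_out (S \<nu>) b) (block_data directed (n \<nu>) (cm_label (S \<nu>)) (Y \<nu>) b) (cm_out_size (S \<nu>) b)\<bar> \<le> A"
      if "b \<in> off_blocks directed (n \<nu>) (cm_label (S \<nu>))" for b
      using out[of "(\<nu>, b)"] elim that by simp
    have inn': "0 < marginal (cm_in (S \<nu>) k t) (community_data directed (n \<nu>) (cm_label (S \<nu>)) (Y \<nu>) k) \<and>
        \<bar>ln (marginal (cm_in (S \<nu>) k t) (community_data directed (n \<nu>) (cm_label (S \<nu>)) (Y \<nu>) k)) -
          in_score directed (n \<nu>) (Y \<nu>) (S \<nu>) k t\<bar> \<le> B"
      if "k \<in> communities (n \<nu>) (cm_label (S \<nu>))" "t \<in> T" for k t
      using inn[of "(\<nu>, k, t)"] elim that by (simp add: in_score_def)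
    show ?case
    proof
      show "0 < cm_prob (S \<nu>) (Y \<nu>) (cm_label (S \<nu>))"
        by (rule log_remainder_bound(1)[OF T _ fact _ _ c]) (erule \<pi> | erule out' | (erule inn', assumption))+
      show "\<bar>log_remainder directed T (n \<nu>) (Y \<nu>) (S \<nu>)\<bar> \<le> c * complexity directed (n \<nu>) (S \<nu>)"
        by (rule log_remainder_bound(2)[OF T _ fact _ _ c]) (erule \<pi> | erule out' | (erule inn', assumption))+
    qed
  qed
  then show thesis using that c(3) by blast
qed

lemma fit_minus_penalty:
  assumes "finite T" "best_types directed T n Y S \<tau>"
  shows "fit directed n Y S \<tau> - penalty directed n S \<tau> = score directed T n Y S"
proof -
  have "in_score directed n Y S k (\<tau> k) = Max (in_score directed n Y S k ` T)"
    if "k \<in> communities n (cm_label S)" for k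
  proof -
    have "is_arg_max (in_score directed n Y S k) (\<lambda>t. t \<in> T) (\<tau> k)"
      using assms(2) that by (simp add: best_types_def)
    then show ?thesis
      using assms(1) by (intro Max_eqI[symmetric]) (auto simp: is_arg_max_linorder)
  qed
  then have "(\<Sum>k\<in>communities n (cm_label S). Max (in_score directed n Y S k ` T))
      = (\<Sum>k\<in>communities n (cm_label S). in_score directed n Y S k (\<tau> k))"
    by simp
  then show ?thesis
    by (simp add: fit_def penalty_def score_def in_score_def laplace_score_def sum_subtractf)
qed

text \<open>There are at most \<open>K\<^sup>2\<close> blocks for \<open>K\<close> communities, so the complexity is at most \<open>K (K + 1)\<close>, and in both
  regimes \<open>K + 1 = O(log n)\<close>. Along a sequence where \<open>n\<close> need not grow, this last estimate requires
  \<open>n \<ge> 2\<close>. The case \<open>n = 1\<close>, where \<open>log n = 0\<close> but \<open>K = 1\<close>, is eventually excluded by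
  \<open>K = O(log n)\<close>, and for \<open>n = 0\<close> both sides vanish.\<close>

lemma complexity_bigo_communities_log:
  fixes S :: "nat \<Rightarrow> ('y, 't, 'p, 'q) collapsed_model"
  assumes "(filterlim n at_top sequentially \<and> (\<exists>A. \<forall>\<nu>. num_communities (n \<nu>) (cm_label (S \<nu>)) \<le> A)) \<or>
      (\<lambda>\<nu>. real (num_communities (n \<nu>) (cm_label (S \<nu>)))) \<in> O(\<lambda>\<nu>. ln (real (n \<nu>)))"
  shows "(\<lambda>\<nu>. complexity directed (n \<nu>) (S \<nu>))
    \<in> O(\<lambda>\<nu>. real (num_communities (n \<nu>) (cm_label (S \<nu>))) * ln (real (n \<nu>)))"
proof -
  let ?K = "\<lambda>\<nu>. num_communities (n \<nu>) (cm_label (S \<nu>))"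
  have "\<exists>c. \<forall>\<^sub>F \<nu> in sequentially. ?K \<nu> = 0 \<or> 2 \<le> n \<nu> \<and> real (?K \<nu>) + 1 \<le> c * ln (real (n \<nu>))"
    using assms
  proof
    assume "filterlim n at_top sequentially \<and> (\<exists>A. \<forall>\<nu>. ?K \<nu> \<le> A)"
    then obtain A where n: "filterlim n at_top sequentially" and A: "\<And>\<nu>. ?K \<nu> \<le> A" by blast
    have "\<forall>\<^sub>F \<nu> in sequentially. 2 \<le> n \<nu>" using n by (simp add: filterlim_at_top)
    then have "\<forall>\<^sub>F \<nu> in sequentially. 2 \<le> n \<nu> \<and> real (?K \<nu>) + 1 \<le> (real A + 1) / ln 2 * ln (real (n \<nu>))"
    proof eventually_elim
      case (elim \<nu>)
      have "real (?K \<nu>) + 1 \<le> (real A + 1) / ln 2 * ln 2" using A[of \<nu>] by simp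
      also have "\<dots> \<le> (real A + 1) / ln 2 * ln (real (n \<nu>))" using elim by (intro mult_left_mono) auto
      finally show ?case using elim by simp
    qed
    then show ?thesis by (intro exI[of _ "(real A + 1) / ln 2"]) (erule eventually_mono, blast)
  next
    assume "(\<lambda>\<nu>. real (?K \<nu>)) \<in> O(\<lambda>\<nu>. ln (real (n \<nu>)))"
    then obtain c where c: "0 < c" "\<forall>\<^sub>F \<nu> in sequentially. norm (real (?K \<nu>)) \<le> c * norm (ln (real (n \<nu>)))"
      by (elim landau_o.bigE)
    from c(2) have "\<forall>\<^sub>F \<nu> in sequentially. ?K \<nu> = 0 \<or> 2 \<le> n \<nu> \<and> real (?K \<nu>) + 1 \<le> (c + 1 / ln 2) * ln (real (n \<nu>))"
    proof eventually_elim
      case (elim \<nu>)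
      show ?case
      proof (cases "2 \<le> n \<nu>")
        case True
        have "ln 2 \<le> ln (real (n \<nu>))" using True by simp
        then have "1 \<le> 1 / ln 2 * ln (real (n \<nu>))" by (simp add: field_simps)
        moreover have "real (?K \<nu>) \<le> c * ln (real (n \<nu>))" using elim True by simp
        ultimately have "real (?K \<nu>) + 1 \<le> (c + 1 / ln 2) * ln (real (n \<nu>))"
          unfolding distrib_right by linarith
        then show ?thesis using True by blast
      next
        case False
        then have "n \<nu> = 0 \<or> n \<nu> = 1" by auto
        then show ?thesis using elim by auto
      qed
    qed
    then show ?thesis by blast
  qed
  then obtain c where c: "\<forall>\<^sub>F \<nu> in sequentially. ?K \<nu> = 0 \<or> 2 \<le> n \<nu> \<and> real (?K \<nu>) + 1 \<le> c * ln (real (n \<nu>))"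
    by blast
  show ?thesis
  proof (rule bigoI)
    show "\<forall>\<^sub>F \<nu> in sequentially. norm (complexity directed (n \<nu>) (S \<nu>)) \<le> c * norm (real (?K \<nu>) * ln (real (n \<nu>)))"
      using c
    proof eventually_elim
      case (elim \<nu>)
      have "norm (complexity directed (n \<nu>) (S \<nu>)) \<le> real (?K \<nu>) * (real (?K \<nu>) + 1)"
        using complexity_le[of directed "n \<nu>" "S \<nu>"] complexity_nonneg[of directed "n \<nu>" "S \<nu>"] by simp
      also have "\<dots> \<le> c * norm (real (?K \<nu>) * ln (real (n \<nu>)))"
      proof (cases "?K \<nu> = 0")
        case False
        then have "real (?K \<nu>) * (real (?K \<nu>) + 1) \<le> real (?K \<nu>) * (c * ln (real (n \<nu>)))"
          using elim by (intro mult_left_mono) auto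
        then show ?thesis using elim False by (simp add: ac_simps)
      qed simp
      finally show ?case .
    qed
  qed
qed

theorem theorem3p6:
  fixes directed :: bool
    and T :: "'t set" and \<pi> :: "'t \<Rightarrow> real"
    and n :: "nat \<Rightarrow> nat" and Y :: "nat \<Rightarrow> nat \<times> nat \<Rightarrow> 'y"
    and S :: "nat \<Rightarrow> ('y, 't, 'p::{second_countable_topology, t2_space},
                              'q::{second_countable_topology, t2_space}) collapsed_model"
  assumes "finite T" and "T \<noteq> {}" and "\<And>t. t \<in> T \<Longrightarrow> 0 < \<pi> t"
    and "laplace_regime directed T \<pi> n Y S"
    and "sizes_diverge directed T n S"
  shows
    "((\<lambda>\<nu>. log_remainder directed T (n \<nu>) (Y \<nu>) (S \<nu>)) \<in> O(\<lambda>\<nu>. complexity directed (n \<nu>) (S \<nu>))) \<and>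

     ((filterlim n at_top sequentially \<and> (\<exists>A. \<forall>\<nu>. num_communities (n \<nu>) (cm_label (S \<nu>)) \<le> A)) \<or>
      (\<lambda>\<nu>. real (num_communities (n \<nu>) (cm_label (S \<nu>)))) \<in> O(\<lambda>\<nu>. ln (real (n \<nu>))) \<longrightarrow>
      (\<lambda>\<nu>. log_remainder directed T (n \<nu>) (Y \<nu>) (S \<nu>))
        \<in> O(\<lambda>\<nu>. real (num_communities (n \<nu>) (cm_label (S \<nu>))) * ln (real (n \<nu>)))) \<and>

     (\<forall>S' :: nat \<Rightarrow> ('y, 't, 'p, 'q) collapsed_model.
        laplace_regime directed T \<pi> n Y S' \<and> sizes_diverge directed T n S' \<longrightarrow>
        (\<exists>A. \<forall>\<^sub>F \<nu> in sequentially. \<forall>\<tau> \<tau>'.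
           best_types directed T (n \<nu>) (Y \<nu>) (S \<nu>) \<tau> \<longrightarrow>
           best_types directed T (n \<nu>) (Y \<nu>) (S' \<nu>) \<tau>' \<longrightarrow>
           (let gain = fit directed (n \<nu>) (Y \<nu>) (S' \<nu>) \<tau>' - fit directed (n \<nu>) (Y \<nu>) (S \<nu>) \<tau>;
                cost = penalty directed (n \<nu>) (S' \<nu>) \<tau>' - penalty directed (n \<nu>) (S \<nu>) \<tau>;
                err = A * (complexity directed (n \<nu>) (S \<nu>) + complexity directed (n \<nu>) (S' \<nu>))
            in \<bar>(log_prob (Y \<nu>) (S' \<nu>) - log_prob (Y \<nu>) (S \<nu>)) - (gain - cost)\<bar> \<le> err \<and>
               (gain < cost - err \<longrightarrow>
                  cm_prob (S' \<nu>) (Y \<nu>) (cm_label (S' \<nu>)) < cm_prob (S \<nu>) (Y \<nu>) (cm_label (S \<nu>))))))"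
proof (intro conjI impI allI)
  obtain c where c: "0 \<le> c"
    "\<forall>\<^sub>F \<nu> in sequentially. 0 < cm_prob (S \<nu>) (Y \<nu>) (cm_label (S \<nu>)) \<and>
       \<bar>log_remainder directed T (n \<nu>) (Y \<nu>) (S \<nu>)\<bar> \<le> c * complexity directed (n \<nu>) (S \<nu>)"
    by (rule eventually_log_remainder_bound[OF assms])
  show bigo: "(\<lambda>\<nu>. log_remainder directed T (n \<nu>) (Y \<nu>) (S \<nu>)) \<in> O(\<lambda>\<nu>. complexity directed (n \<nu>) (S \<nu>))"
    by (rule bigoI[of _ c]) (use c(2) in eventually_elim, simp add: complexity_nonneg)
  show "(\<lambda>\<nu>. log_remainder directed T (n \<nu>) (Y \<nu>) (S \<nu>))
      \<in> O(\<lambda>\<nu>. real (num_communities (n \<nu>) (cm_label (S \<nu>))) * ln (real (n \<nu>)))"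
    if "(filterlim n at_top sequentially \<and> (\<exists>A. \<forall>\<nu>. num_communities (n \<nu>) (cm_label (S \<nu>)) \<le> A)) \<or>
      (\<lambda>\<nu>. real (num_communities (n \<nu>) (cm_label (S \<nu>)))) \<in> O(\<lambda>\<nu>. ln (real (n \<nu>)))"
    using bigo complexity_bigo_communities_log[OF that] by (rule landau_o.big_trans)
  fix S' :: "nat \<Rightarrow> ('y, 't, 'p, 'q) collapsed_model"
  assume "laplace_regime directed T \<pi> n Y S' \<and> sizes_diverge directed T n S'"
  then have S': "laplace_regime directed T \<pi> n Y S'" "sizes_diverge directed T n S'" by auto
  obtain c' where c': "0 \<le> c'"
    "\<forall>\<^sub>F \<nu> in sequentially. 0 < cm_prob (S' \<nu>) (Y \<nu>) (cm_label (S' \<nu>)) \<and>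
       \<bar>log_remainder directed T (n \<nu>) (Y \<nu>) (S' \<nu>)\<bar> \<le> c' * complexity directed (n \<nu>) (S' \<nu>)"
    by (rule eventually_log_remainder_bound[OF assms(1-3) S'])
  show "\<exists>A. \<forall>\<^sub>F \<nu> in sequentially. \<forall>\<tau> \<tau>'.
           best_types directed T (n \<nu>) (Y \<nu>) (S \<nu>) \<tau> \<longrightarrow>
           best_types directed T (n \<nu>) (Y \<nu>) (S' \<nu>) \<tau>' \<longrightarrow>
           (let gain = fit directed (n \<nu>) (Y \<nu>) (S' \<nu>) \<tau>' - fit directed (n \<nu>) (Y \<nu>) (S \<nu>) \<tau>;
                cost = penalty directed (n \<nu>) (S' \<nu>) \<tau>' - penalty directed (n \<nu>) (S \<nu>) \<tau>;
                err = A * (complexity directed (n \<nu>) (S \<nu>) + complexity directed (n \<nu>) (S' \<nu>))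
            in \<bar>(log_prob (Y \<nu>) (S' \<nu>) - log_prob (Y \<nu>) (S \<nu>)) - (gain - cost)\<bar> \<le> err \<and>
               (gain < cost - err \<longrightarrow>
                  cm_prob (S' \<nu>) (Y \<nu>) (cm_label (S' \<nu>)) < cm_prob (S \<nu>) (Y \<nu>) (cm_label (S \<nu>))))"
  proof (rule exI[of _ "max c c'"], use c(2) c'(2) in eventually_elim, intro allI impI)
    fix \<nu> \<tau> \<tau>'
    assume S: "0 < cm_prob (S \<nu>) (Y \<nu>) (cm_label (S \<nu>)) \<and>
        \<bar>log_remainder directed T (n \<nu>) (Y \<nu>) (S \<nu>)\<bar> \<le> c * complexity directed (n \<nu>) (S \<nu>)"
      and S': "0 < cm_prob (S' \<nu>) (Y \<nu>) (cm_label (S' \<nu>)) \<and>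
        \<bar>log_remainder directed T (n \<nu>) (Y \<nu>) (S' \<nu>)\<bar> \<le> c' * complexity directed (n \<nu>) (S' \<nu>)"
      and \<tau>: "best_types directed T (n \<nu>) (Y \<nu>) (S \<nu>) \<tau>"
      and \<tau>': "best_types directed T (n \<nu>) (Y \<nu>) (S' \<nu>) \<tau>'"
    let ?gain = "fit directed (n \<nu>) (Y \<nu>) (S' \<nu>) \<tau>' - fit directed (n \<nu>) (Y \<nu>) (S \<nu>) \<tau>"
    let ?cost = "penalty directed (n \<nu>) (S' \<nu>) \<tau>' - penalty directed (n \<nu>) (S \<nu>) \<tau>"
    let ?err = "max c c' * (complexity directed (n \<nu>) (S \<nu>) + complexity directed (n \<nu>) (S' \<nu>))"
    have "c * complexity directed (n \<nu>) (S \<nu>) \<le> max c c' * complexity directed (n \<nu>) (S \<nu>)"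
      "c' * complexity directed (n \<nu>) (S' \<nu>) \<le> max c c' * complexity directed (n \<nu>) (S' \<nu>)"
      by (intro mult_right_mono complexity_nonneg; simp)+
    then have err: "\<bar>log_remainder directed T (n \<nu>) (Y \<nu>) (S \<nu>)\<bar>
        + \<bar>log_remainder directed T (n \<nu>) (Y \<nu>) (S' \<nu>)\<bar> \<le> ?err"
      using S S' by (simp only: distrib_left) linarith
    have diff: "(log_prob (Y \<nu>) (S' \<nu>) - log_prob (Y \<nu>) (S \<nu>)) - (?gain - ?cost)
        = log_remainder directed T (n \<nu>) (Y \<nu>) (S' \<nu>) - log_remainder directed T (n \<nu>) (Y \<nu>) (S \<nu>)"
      using fit_minus_penalty[OF assms(1) \<tau>] fit_minus_penalty[OF assms(1) \<tau>']
      unfolding log_remainder_def by linarith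
    have close: "\<bar>(log_prob (Y \<nu>) (S' \<nu>) - log_prob (Y \<nu>) (S \<nu>)) - (?gain - ?cost)\<bar> \<le> ?err"
      unfolding diff using err by linarith
    moreover have "cm_prob (S' \<nu>) (Y \<nu>) (cm_label (S' \<nu>)) < cm_prob (S \<nu>) (Y \<nu>) (cm_label (S \<nu>))"
      if "?gain < ?cost - ?err"
    proof -
      have "log_prob (Y \<nu>) (S' \<nu>) < log_prob (Y \<nu>) (S \<nu>)" using close that by linarith
      then show ?thesis using S S' by (simp add: log_prob_def)
    qed
    ultimately show "let gain = ?gain; cost = ?cost; err = ?err
        in \<bar>(log_prob (Y \<nu>) (S' \<nu>) - log_prob (Y \<nu>) (S \<nu>)) - (gain - cost)\<bar> \<le> err \<and>
           (gain < cost - err \<longrightarrow>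
              cm_prob (S' \<nu>) (Y \<nu>) (cm_label (S' \<nu>)) < cm_prob (S \<nu>) (Y \<nu>) (cm_label (S \<nu>)))"
      unfolding Let_def by blast
  qed
qed

end
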